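(* For every fixed integer $k$, the restricted $k$-list colouring problem restricted to $P_5$-free graphs can be solved in polynomial time.
   Context: A $P_5$-free graph is a graph with no induced path on five vertices. In the restricted $k$-list colouring problem, one is given a graph $G$ and for each vertex $v$ a list $l(v)\subseteq\{1,2,\dots,k\}$, and must decide whether there is a proper colouring of $G$ (adjacent vertices get different colours) in which every vertex receives a colour from its list. *)

theory Defs
  imports
    "HOL-Computational_Algebra.Polynomial"
    "Graph_Theory.Pair_Digraph"
begin

section \<open>Random access machines\<close>

text \<open>
  The machine model is the random access machine of Cook and Reckhow, with registers \<open>X 0\<close>, \<open>X 1\<close>, ...
  holding natural numbers, indirect addressing, and a read-once input tape of bits. Every instruction
  costs one time unit. Since addition and (truncated) subtraction are the only arithmetic
  instructions, a value computed in \<open>t\<close> steps has at most \<open>t + c\<close> bits for a constant \<open>c\<close> depending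
  only on the program. Hence the time used by such a machine is polynomially related to that of a
  Turing machine; with a multiplication instruction this would fail.
\<close>

datatype instr =
    SetConst nat nat     \<comment> \<open>\<open>SetConst i c\<close>: \<open>X i := c\<close>\<close>
  | Add nat nat nat      \<comment> \<open>\<open>Add i j m\<close>: \<open>X i := X j + X m\<close>\<close>
  | Sub nat nat nat      \<comment> \<open>\<open>Sub i j m\<close>: \<open>X i := X j - X m\<close>, truncated at \<open>0\<close>\<close>
  | Load nat nat         \<comment> \<open>\<open>Load i j\<close>: \<open>X i := X (X j)\<close>\<close>
  | Store nat nat        \<comment> \<open>\<open>Store i j\<close>: \<open>X (X i) := X j\<close>\<close>
  | Read nat             \<comment> \<open>\<open>Read i\<close>: \<open>X i :=\<close> next input bit, or \<open>2\<close> at the end of the input\<close>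
  | JumpPos nat nat      \<comment> \<open>\<open>JumpPos i a\<close>: continue at address \<open>a\<close> if \<open>X i > 0\<close>\<close>

type_synonym program = "instr list"

text \<open>Program counter, unread part of the input, registers.\<close>

type_synonym config = "nat \<times> bool list \<times> (nat \<Rightarrow> nat)"

fun exec :: "instr \<Rightarrow> config \<Rightarrow> config" where
  "exec (SetConst i c) (pc, w, X) = (pc + 1, w, X(i := c))"
| "exec (Add i j m) (pc, w, X) = (pc + 1, w, X(i := X j + X m))"
| "exec (Sub i j m) (pc, w, X) = (pc + 1, w, X(i := X j - X m))"
| "exec (Load i j) (pc, w, X) = (pc + 1, w, X(i := X (X j)))"
| "exec (Store i j) (pc, w, X) = (pc + 1, w, X(X i := X j))"
| "exec (Read i) (pc, [], X) = (pc + 1, [], X(i := 2))"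
| "exec (Read i) (pc, b # w, X) = (pc + 1, w, X(i := of_bool b))"
| "exec (JumpPos i a) (pc, w, X) = (if X i > 0 then a else pc + 1, w, X)"

text \<open>The machine halts by leaving its program, and then accepts if \<open>X 0\<close> is nonzero.\<close>

definition halted :: "program \<Rightarrow> config \<Rightarrow> bool" where
  "halted P s \<longleftrightarrow> length P \<le> fst s"

definition step :: "program \<Rightarrow> config \<Rightarrow> config" where
  "step P s = (if halted P s then s else exec (P ! fst s) s)"

definition init :: "bool list \<Rightarrow> config" where
  "init w = (0, w, \<lambda>_. 0)"

definition accepting :: "config \<Rightarrow> bool" where
  "accepting s \<longleftrightarrow> snd (snd s) 0 \<noteq> 0"

definition decides_within :: "program \<Rightarrow> nat \<Rightarrow> bool list \<Rightarrow> bool \<Rightarrow> bool" where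
  "decides_within P T w answer \<longleftrightarrow>
     (\<exists>t\<le>T. halted P ((step P ^^ t) (init w)) \<and> (accepting ((step P ^^ t) (init w)) \<longleftrightarrow> answer))"

text \<open>
  The decision problem with instances \<open>I\<close>, encoded as bit strings by \<open>enc\<close>, and yes-instances \<open>Q\<close>
  is solvable in polynomial time: one program and one polynomial serve all instances. Nothing is
  required of the program on bit strings that do not encode an element of \<open>I\<close>.
\<close>

definition poly_time_solvable :: "'i set \<Rightarrow> ('i \<Rightarrow> bool list) \<Rightarrow> ('i \<Rightarrow> bool) \<Rightarrow> bool" where
  "poly_time_solvable I enc Q \<longleftrightarrow>
     (\<exists>(P :: program) (p :: nat poly). \<forall>x\<in>I.
        decides_within P (poly p (length (enc x))) (enc x) (Q x))"


section \<open>Graphs and list colourings\<close>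

text \<open>
  A finite simple undirected graph is a \<open>pair_graph\<close>, where an edge \<open>uv\<close> is represented by the two
  arcs \<open>(u, v)\<close> and \<open>(v, u)\<close>.
\<close>

definition induced_path5 :: "'a pair_pre_digraph \<Rightarrow> (nat \<Rightarrow> 'a) \<Rightarrow> bool" where
  "induced_path5 G f \<longleftrightarrow>
     inj_on f {..<5} \<and> f ` {..<5} \<subseteq> pverts G \<and>
     (\<forall>i<5. \<forall>j<5. (f i, f j) \<in> parcs G \<longleftrightarrow> i = j + 1 \<or> j = i + 1)"

definition P5_free :: "'a pair_pre_digraph \<Rightarrow> bool" where
  "P5_free G \<longleftrightarrow> (\<nexists>f. induced_path5 G f)"

definition list_colouring ::
  "'a pair_pre_digraph \<Rightarrow> ('a \<Rightarrow> nat set) \<Rightarrow> ('a \<Rightarrow> nat) \<Rightarrow> bool" where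
  "list_colouring G l c \<longleftrightarrow>
     (\<forall>v\<in>pverts G. c v \<in> l v) \<and> (\<forall>(u, v)\<in>parcs G. c u \<noteq> c v)"

definition list_colourable :: "'a pair_pre_digraph \<times> ('a \<Rightarrow> nat set) \<Rightarrow> bool" where
  "list_colourable = (\<lambda>(G, l). \<exists>c. list_colouring G l c)"

text \<open>As usual for graphs given as input, the vertices are numbered \<open>0, ..., n - 1\<close>.\<close>

definition list_colouring_instances ::
  "nat \<Rightarrow> (nat pair_pre_digraph \<times> (nat \<Rightarrow> nat set)) set" where
  "list_colouring_instances k =
     {(G, l). pair_graph G \<and> (\<exists>n. pverts G = {..<n}) \<and> (\<forall>v\<in>pverts G. l v \<subseteq> {1..k})}"

text \<open>
  The number \<open>n\<close> of vertices in unary, terminated by a zero bit; then the adjacency matrix, row by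
  row; then for each vertex the characteristic vector of its list. This has \<open>n + 1 + n\<^sup>2 + n k\<close> bits,
  so for fixed \<open>k\<close> being polynomial in the length is the same as being polynomial in \<open>n\<close>.
\<close>

definition encode_instance ::
  "nat \<Rightarrow> nat pair_pre_digraph \<times> (nat \<Rightarrow> nat set) \<Rightarrow> bool list" where
  "encode_instance k = (\<lambda>(G, l).
     let n = card (pverts G) in
       replicate n True @ [False]
       @ [(u, v) \<in> parcs G. u \<leftarrow> [0..<n], v \<leftarrow> [0..<n]]
       @ [c \<in> l v. v \<leftarrow> [0..<n], c \<leftarrow> [1..<Suc k]])"

end

theory Submission
  imports Defs "HOL-Library.Ramsey"
begin

text \<open>
  The algorithm establishes \<open>r\<close>-consistency for a constant \<open>r\<close> depending on \<open>k\<close>: it computes the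
  largest family of partial colourings of at most \<open>r\<close> vertices that is closed under restriction and
  in which every member with fewer than \<open>r\<close> vertices can be extended to any further vertex, and it
  accepts if this family is nonempty.

  That a nonempty family \<open>H\<close> yields a list colouring is shown by induction on the number of colours.
  A component of a \<open>P5\<close>-free graph without large cliques has a dominating set \<open>D\<close> of bounded size:
  in a minimal dominating subset of a level, nonadjacent vertices have adjacent private neighbours,
  so that Ramsey's theorem applies. Fix a member of \<open>H\<close> colouring \<open>D\<close> and call a colour live at \<open>v\<close>
  if giving it to \<open>v\<close> stays in \<open>H\<close>. Fixing boundedly many further vertices achieves that adjacent
  vertices with different neighbourhoods in \<open>D\<close> have no common live colour. The vertices
  with the same neighbourhood in \<open>D\<close> have all lost a colour, so the induction hypothesis colours each
  of these classes separately, and the colourings fit together.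
\<close>

section \<open>Domination in P5-free graphs\<close>

text \<open>Correctness is argued from members of \<open>H\<close> alone, so every choice in the
  argument has to be an extension of one member by a number of vertices that depends only on
  \<open>k\<close>; \<open>width\<close> adds up these extensions. In return the machine guesses
  nothing and knows no graph theory: it only deletes positions, for polynomially many rounds. The
  obstacle is that each extension shrinks the live sets of vertices already dealt with. Shrinking
  never creates a conflict, but a conflict at \<open>w\<close> can only be removed up to the
  alternative that \<open>w\<close> loses some other live colour. Hence conflicts are treated by
  decreasing size of the live set at \<open>w\<close>: a set that shrinks is left to a later round,
  and there are only as many rounds as colours. A round is bounded because a conflict is described
  by two subsets of \<open>D\<close>, a live set and a colour.\<close>

definition ramsey_bound :: "nat \<Rightarrow> nat" where
  "ramsey_bound m = (SOME r. \<forall>(V :: nat set) E. finite V \<and> card V \<ge> r \<longrightarrow>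
     (\<exists>R\<subseteq>V. card R = Suc m \<and> clique R E \<or> card R = Suc m \<and> indep R E))"

text \<open>Choosing the bound by \<open>SOME\<close> makes it a function of \<open>m\<close>, so
  that \<open>width\<close> can be defined by recursion. Both sizes are \<open>Suc m\<close> because
  cliques with \<open>m\<close> vertices may occur.\<close>

lemma ramsey_bound:
  assumes "finite (V :: nat set)" "card V \<ge> ramsey_bound m"
  shows "\<exists>R\<subseteq>V. card R = Suc m \<and> clique R E \<or> card R = Suc m \<and> indep R E"
proof -
  obtain r where r: "\<forall>(V :: nat set) E. finite V \<and> card V \<ge> r \<longrightarrow>
     (\<exists>R\<subseteq>V. card R = Suc m \<and> clique R E \<or> card R = Suc m \<and> indep R E)"
    using ramsey2[of "Suc m" "Suc m"] by blast
  show ?thesis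
    using someI[of "\<lambda>r. \<forall>(V :: nat set) E. finite V \<and> card V \<ge> r \<longrightarrow>
     (\<exists>R\<subseteq>V. card R = Suc m \<and> clique R E \<or> card R = Suc m \<and> indep R E)", OF r] assms
    unfolding ramsey_bound_def[symmetric] by blast
qed

locale p5_free_graph =
  fixes E :: "nat \<Rightarrow> nat \<Rightarrow> bool"
  assumes sym: "E u v \<Longrightarrow> E v u"
    and irrefl: "\<not> E v v"
    and no_p5: "\<lbrakk>E a b; E b c; E c d; E d e; \<not> E a c; \<not> E a d; \<not> E a e; \<not> E b d; \<not> E b e; \<not> E c e\<rbrakk>
      \<Longrightarrow> False"
begin

lemma commute: "E u v \<longleftrightarrow> E v u"
  using sym by blast

definition adjacent_set :: "nat set \<Rightarrow> bool" where
  "adjacent_set K \<longleftrightarrow> (\<forall>u\<in>K. \<forall>v\<in>K. u \<noteq> v \<longrightarrow> E u v)"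

text \<open>The absence of an induced \<open>P5\<close> enters only through
  \<open>private_edge\<close>, because the lemma serves three pairs \<open>Z\<close>,
  \<open>W\<close>: two pairs of consecutive distance levels and the sets in
  \<open>decouple_step\<close>. Cliques are bounded on both sides since an independent part of
  \<open>A\<close> yields a clique of private neighbours in \<open>W\<close>.\<close>

lemma bounded_dominating_subset:
  assumes "finite Z"
    and dom: "\<And>w. w \<in> W \<Longrightarrow> \<exists>z\<in>Z. E z w"
    and clique: "\<And>K. \<lbrakk>K \<subseteq> Z \<or> K \<subseteq> W; finite K; adjacent_set K\<rbrakk> \<Longrightarrow> card K \<le> m"
    and private_edge: "\<And>a b a' b'. \<lbrakk>a \<in> Z; b \<in> Z; a' \<in> W; b' \<in> W; a \<noteq> b; \<not> E a b; E a a'; E b b';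
      \<not> E a b'; \<not> E b a'\<rbrakk> \<Longrightarrow> E a' b'"
  shows "\<exists>A\<subseteq>Z. card A \<le> ramsey_bound m \<and> (\<forall>w\<in>W. \<exists>a\<in>A. E a w)"
proof -
  let ?D = "\<lambda>A. A \<subseteq> Z \<and> (\<forall>w\<in>W. \<exists>a\<in>A. E a w)"
  have "?D Z" using dom by blast
  then have "?D (arg_min card ?D)" "\<And>B. ?D B \<Longrightarrow> card (arg_min card ?D) \<le> card B"
    by (rule arg_min_natI) (rule arg_min_nat_le)
  then obtain A where A: "?D A" and min: "\<And>B. ?D B \<Longrightarrow> card A \<le> card B"
    by blast
  have finA: "finite A" using A \<open>finite Z\<close> finite_subset by blast
  have "\<exists>w. w \<in> W \<and> E a w \<and> (\<forall>b\<in>A - {a}. \<not> E b w)" if "a \<in> A" for a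
  proof (rule ccontr)
    assume *: "\<not> ?thesis"
    have "?D (A - {a})" using A * by blast
    then have "card A \<le> card (A - {a})" by (rule min)
    then show False using card_Diff1_less[OF finA that] by simp
  qed
  then obtain p where p: "\<And>a. a \<in> A \<Longrightarrow> p a \<in> W \<and> E a (p a) \<and> (\<forall>b\<in>A - {a}. \<not> E b (p a))"
    by metis
  have inj: "inj_on p A"
  proof (rule inj_onI, rule ccontr)
    fix a b assume "a \<in> A" "b \<in> A" "p a = p b" "a \<noteq> b"
    then show False using p[of a] p[of b] by auto
  qed
  have "card A \<le> ramsey_bound m"
  proof (rule ccontr)
    assume "\<not> ?thesis"
    then obtain R where R: "R \<subseteq> A" "card R = Suc m"
      and cases: "clique R {{u, v} |u v. E u v} \<or> indep R {{u, v} |u v. E u v}"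
      using ramsey_bound[OF finA, of m "{{u, v} |u v. E u v}"] by auto
    have finR: "finite R" using R finA finite_subset by blast
    from cases show False
    proof
      assume "clique R {{u, v} |u v. E u v}"
      then have "adjacent_set R"
        unfolding clique_def adjacent_set_def by (auto simp: doubleton_eq_iff dest: sym)
      then show False using clique[of R] R A finR by force
    next
      assume "indep R {{u, v} |u v. E u v}"
      then have ind: "\<And>u v. \<lbrakk>u \<in> R; v \<in> R; u \<noteq> v\<rbrakk> \<Longrightarrow> \<not> E u v"
        unfolding indep_def by blast
      have "E (p a) (p b)" if "a \<in> R" "b \<in> R" "a \<noteq> b" for a b
      proof -
        have "a \<in> A" "b \<in> A" using that R by auto
        then show ?thesis
          using private_edge[of a b "p a" "p b"] p[of a] p[of b] ind[OF that] that A by auto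
      qed
      then have "adjacent_set (p ` R)"
        unfolding adjacent_set_def by auto
      moreover have "card (p ` R) = Suc m"
        using R inj card_image inj_on_subset by metis
      ultimately show False using clique[of "p ` R"] R finR p by force
    qed
  qed
  then show ?thesis using A by blast
qed

definition closed_within :: "nat set \<Rightarrow> nat set \<Rightarrow> bool" where
  "closed_within V S \<longleftrightarrow> (\<forall>x\<in>S. \<forall>y\<in>V. E x y \<longrightarrow> y \<in> S)"

text \<open>\<open>S\<close> consists of the vertices at distance at most 3 from \<open>v0\<close>; it is a whole component since a
  shortest path with five vertices would be induced.\<close>

lemma bounded_domination:
  assumes fin: "finite V" and v0: "v0 \<in> V"
    and clique: "\<And>K. \<lbrakk>K \<subseteq> V; finite K; adjacent_set K\<rbrakk> \<Longrightarrow> card K \<le> m"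
  shows "\<exists>S D. v0 \<in> S \<and> S \<subseteq> V \<and> closed_within V S \<and> D \<subseteq> S \<and> card D \<le> 1 + 2 * ramsey_bound m \<and>
    (\<forall>v\<in>S - D. \<exists>x\<in>D. E x v)"
proof -
  define N1 where "N1 = {v\<in>V. E v0 v}"
  define N2 where "N2 = {v\<in>V. v \<noteq> v0 \<and> \<not> E v0 v \<and> (\<exists>a\<in>N1. E a v)}"
  define N3 where "N3 = {v\<in>V. v \<noteq> v0 \<and> \<not> E v0 v \<and> v \<notin> N2 \<and> (\<exists>b\<in>N2. E b v)}"
  have N13: "\<not> E a v" if "a \<in> N1" "v \<in> N3" for a v
    using that unfolding N1_def N2_def N3_def by blast
  have N12: "\<not> E v0 v" if "v \<in> N2" for v using that N2_def by blast
  have N01: "E v0 v" if "v \<in> N1" for v using that N1_def by blast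
  have NV: "N1 \<subseteq> V" "N2 \<subseteq> V" "N3 \<subseteq> V" unfolding N1_def N2_def N3_def by auto
  have N21: "\<exists>a\<in>N1. E a v" if "v \<in> N2" for v using that N2_def by blast
  have N32: "\<exists>a\<in>N2. E a v" if "v \<in> N3" for v using that N3_def by blast
  let ?S = "insert v0 (N1 \<union> N2 \<union> N3)"
  have "y \<in> ?S" if "x \<in> ?S" "y \<in> V" "E x y" for x y
  proof (rule ccontr)
    assume y: "y \<notin> ?S"
    then have y': "\<not> E v0 y" "y \<noteq> v0" "\<And>a. a \<in> N1 \<Longrightarrow> \<not> E a y" "\<And>b. b \<in> N2 \<Longrightarrow> \<not> E b y"
      using \<open>y \<in> V\<close> unfolding N1_def N2_def N3_def by blast+
    have "x \<in> N3" using that y' by blast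
    then obtain b where b: "b \<in> N2" "E b x" using N32 by blast
    then obtain a where a: "a \<in> N1" "E a b" using N21 by blast
    have "\<not> E v0 x" using \<open>x \<in> N3\<close> N3_def by blast
    then show False
      using no_p5[of v0 a b x y] a b y' N01[OF a(1)] N12[OF b(1)] N13[OF a(1) \<open>x \<in> N3\<close>] \<open>E x y\<close>
      by blast
  qed
  then have closed: "closed_within V ?S" unfolding closed_within_def by blast
  have "\<exists>A\<subseteq>N1. card A \<le> ramsey_bound m \<and> (\<forall>w\<in>N2. \<exists>a\<in>A. E a w)"
  proof (rule bounded_dominating_subset)
    show "finite N1" using NV fin finite_subset by blast
    show "\<exists>z\<in>N1. E z w" if "w \<in> N2" for w using that N21 by blast
    show "card K \<le> m" if "K \<subseteq> N1 \<or> K \<subseteq> N2" "finite K" "adjacent_set K" for K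
      using clique[of K] that NV by blast
    \<comment> \<open>Otherwise \<open>a' a v0 b b'\<close> would be an induced path through the
      root.\<close>
    show "E a' b'" if "a \<in> N1" "b \<in> N1" "a' \<in> N2" "b' \<in> N2" "a \<noteq> b" "\<not> E a b" "E a a'" "E b b'"
      "\<not> E a b'" "\<not> E b a'" for a b a' b'
      using no_p5[of a' a v0 b b'] that N01[of a] N01[of b] N12[of a'] N12[of b']
      by (auto simp: commute)
  qed
  then obtain A where A: "A \<subseteq> N1" "card A \<le> ramsey_bound m" "\<And>w. w \<in> N2 \<Longrightarrow> \<exists>a\<in>A. E a w" by blast
  have "\<exists>B\<subseteq>N2. card B \<le> ramsey_bound m \<and> (\<forall>w\<in>N3. \<exists>a\<in>B. E a w)"
  proof (rule bounded_dominating_subset)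
    show "finite N2" using NV fin finite_subset by blast
    show "\<exists>z\<in>N2. E z w" if "w \<in> N3" for w using that N32 by blast
    show "card K \<le> m" if "K \<subseteq> N2 \<or> K \<subseteq> N3" "finite K" "adjacent_set K" for K
      using clique[of K] that NV by blast
    show "E b1' b2'" if b: "b1 \<in> N2" "b2 \<in> N2" "b1' \<in> N3" "b2' \<in> N3" "b1 \<noteq> b2" "\<not> E b1 b2"
      "E b1 b1'" "E b2 b2'" "\<not> E b1 b2'" "\<not> E b2 b1'" for b1 b2 b1' b2'
    proof (rule ccontr)
      assume non: "\<not> E b1' b2'"
      obtain a1 a2 where a: "a1 \<in> N1" "E a1 b1" "a2 \<in> N1" "E a2 b2" using N21 b by metis
      \<comment> \<open>A common neighbour \<open>a\<close> of \<open>b1\<close> and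
        \<open>b2\<close> in \<open>N1\<close> would give the induced path
        \<open>b1' b1 a b2 b2'\<close>.\<close>
      have *: "\<not> E a b2" if "a \<in> N1" "E a b1" for a
        using no_p5[of b1' b1 a b2 b2'] that b non N13[of a b1'] N13[of a b2'] by (auto simp: commute)
      have **: "\<not> E a b1" if "a \<in> N1" "E a b2" for a
        using * that by blast
      \<comment> \<open>The parents \<open>a1\<close> and \<open>a2\<close> are thus distinct. If
        they are adjacent, \<open>b1' b1 a1 a2 b2\<close> is induced, otherwise
        \<open>b1 a1 v0 a2 b2\<close> is.\<close>
      show False
      proof (cases "E a1 a2")
        case True
        then show False
          using no_p5[of b1' b1 a1 a2 b2] a b *[of a1] **[of a2] N13[of a1 b1'] N13[of a2 b1'] True
            by (auto simp: commute)
      next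
        case False
        then show False
          using no_p5[of b1 a1 v0 a2 b2] a b *[of a1] **[of a2] N01[of a1] N01[of a2] N12[of b1] N12[of b2] False
            by (auto simp: commute)
      qed
    qed
  qed
  then obtain B where B: "B \<subseteq> N2" "card B \<le> ramsey_bound m" "\<And>w. w \<in> N3 \<Longrightarrow> \<exists>a\<in>B. E a w" by blast
  \<comment> \<open>\<open>v0\<close> dominates \<open>N1\<close>, \<open>A\<close> dominates
    \<open>N2\<close> and \<open>B\<close> dominates \<open>N3\<close>: one vertex and two Ramsey
    bounds.\<close>
  let ?D = "insert v0 (A \<union> B)"
  have "finite A" "finite B" using A B NV fin by (meson finite_subset)+
  then have "card ?D \<le> 1 + 2 * ramsey_bound m"
    using A(2) B(2) card_Un_le[of A B] card_insert_le_m1[of "Suc (card (A \<union> B))" "A \<union> B" v0]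
    by (simp add: card_insert_if)
  moreover have "\<forall>v\<in>?S - ?D. \<exists>x\<in>?D. E x v" using A B N01 by blast
  moreover have "?S \<subseteq> V" "?D \<subseteq> ?S" using A B NV v0 by blast+
  ultimately show ?thesis using closed
    by (intro exI[of _ ?S] exI[of _ ?D] conjI) (rule insertI1 | assumption)+
qed

end

section \<open>Consistent families of partial colourings\<close>

context p5_free_graph
begin

text \<open>Partial colourings are sets of vertex-colour pairs, with single-valuedness made part of
  properness. Restriction is then the subset order, and extension is \<open>insert\<close>.\<close>

definition proper :: "(nat \<times> nat) set \<Rightarrow> bool" where
  "proper f \<longleftrightarrow> (\<forall>(u, a)\<in>f. \<forall>(v, b)\<in>f. (u = v \<longrightarrow> a = b) \<and> (E u v \<longrightarrow> a \<noteq> b))"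

text \<open>Such a family is a winning strategy for the defender in the existential pebble game with
  \<open>s\<close> pebbles. If \<open>v\<close> is already coloured in \<open>f\<close>, properness
  forces the extension to repeat its colour.\<close>

definition consistent :: "nat \<Rightarrow> nat set \<Rightarrow> nat set \<Rightarrow> (nat \<times> nat) set set \<Rightarrow> bool" where
  "consistent s V C H \<longleftrightarrow> {} \<in> H \<and> (\<forall>f\<in>H. \<forall>g\<subseteq>f. g \<in> H) \<and>
     (\<forall>f\<in>H. finite f \<and> f \<subseteq> V \<times> C \<and> proper f) \<and>
     (\<forall>f\<in>H. card f < s \<longrightarrow> (\<forall>v\<in>V. \<exists>c. insert (v, c) f \<in> H))"

text \<open>Lists occur only through the singletons in \<open>H\<close>. This lets the same notion
  serve in the induction, where \<open>H\<close> is replaced by the colourings compatible with a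
  fixed member and the singletons express liveness.\<close>

definition colouring_from :: "nat set \<Rightarrow> (nat \<times> nat) set set \<Rightarrow> (nat \<Rightarrow> nat) \<Rightarrow> bool" where
  "colouring_from V H col \<longleftrightarrow>
     (\<forall>v\<in>V. {(v, col v)} \<in> H) \<and> (\<forall>u\<in>V. \<forall>v\<in>V. E u v \<longrightarrow> col u \<noteq> col v)"

definition trace_class :: "nat set \<Rightarrow> nat set \<Rightarrow> nat set \<Rightarrow> nat set" where
  "trace_class V D X = {v\<in>V. {x\<in>D. E x v} = X}"

lemma consistent_mono: "consistent s V C H \<Longrightarrow> s' \<le> s \<Longrightarrow> consistent s' V C H"
  unfolding consistent_def by force

lemma consistent_subset:
  assumes "consistent s V C H" "V' \<subseteq> V"
  shows "consistent s V' C {f\<in>H. f \<subseteq> V' \<times> UNIV}"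
proof -
  let ?H = "{f\<in>H. f \<subseteq> V' \<times> UNIV}"
  have H: "{} \<in> H" "\<And>f g. f \<in> H \<Longrightarrow> g \<subseteq> f \<Longrightarrow> g \<in> H"
    "\<And>f. f \<in> H \<Longrightarrow> finite f \<and> f \<subseteq> V \<times> C \<and> proper f"
    "\<And>f v. f \<in> H \<Longrightarrow> card f < s \<Longrightarrow> v \<in> V \<Longrightarrow> \<exists>c. insert (v, c) f \<in> H"
    using assms(1) unfolding consistent_def by blast+
  have "\<exists>c. insert (v, c) f \<in> ?H" if "f \<in> ?H" "card f < s" "v \<in> V'" for f v
    using H(4)[of f v] that assms(2) by auto
  moreover have "f \<subseteq> V' \<times> C" if "f \<in> ?H" for f
    using H(3)[of f] that by blast
  ultimately show ?thesis unfolding consistent_def using H(1,2,3) by auto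
qed

end

section \<open>Decoupling vertices with different neighbourhoods in the dominating set\<close>

locale consistent_family = p5_free_graph +
  fixes s :: nat and V C :: "nat set" and H :: "(nat \<times> nat) set set"
  assumes finite_V: "finite V" and finite_C: "finite C"
    and consistent: "consistent s V C H"
    and card_C: "card C < s"
begin

definition live :: "(nat \<times> nat) set \<Rightarrow> nat \<Rightarrow> nat set" where
  "live f v = {c. insert (v, c) f \<in> H}"

lemma empty_in: "{} \<in> H"
  and down: "f \<in> H \<Longrightarrow> g \<subseteq> f \<Longrightarrow> g \<in> H"
  and finite_mem: "f \<in> H \<Longrightarrow> finite f"
  and subset_mem: "f \<in> H \<Longrightarrow> f \<subseteq> V \<times> C"
  and proper_mem: "f \<in> H \<Longrightarrow> proper f"
  and extend: "f \<in> H \<Longrightarrow> card f < s \<Longrightarrow> v \<in> V \<Longrightarrow> \<exists>c. insert (v, c) f \<in> H"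
  using consistent unfolding consistent_def by blast+

lemma live_subset: "live f v \<subseteq> C"
  using subset_mem unfolding live_def by blast

lemma live_antimono: "f \<subseteq> g \<Longrightarrow> live g v \<subseteq> live f v"
  unfolding live_def using down by (meson Collect_mono insert_mono)

lemma live_neq: "(x, a) \<in> f \<Longrightarrow> E x v \<Longrightarrow> c \<in> live f v \<Longrightarrow> c \<noteq> a"
  unfolding live_def using proper_mem[of "insert (v, c) f"] unfolding proper_def by fastforce

lemma live_mem: "f \<in> H \<Longrightarrow> (v, c) \<in> f \<Longrightarrow> c \<in> live f v"
  unfolding live_def by (simp add: insert_absorb)

lemma extend_set:
  assumes "finite A" "A \<subseteq> V" "f \<in> H" "card f + card A \<le> s"
  shows "\<exists>g\<in>H. f \<subseteq> g \<and> A \<subseteq> fst ` g \<and> card g \<le> card f + card A"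
  using assms
proof (induction A rule: finite_induct)
  case (insert x A)
  then obtain g where g: "g \<in> H" "f \<subseteq> g" "A \<subseteq> fst ` g" "card g \<le> card f + card A" by auto
  moreover have "x \<in> V" "card g < s" using insert g by auto
  ultimately obtain c where "Set.insert (x, c) g \<in> H" using extend by blast
  then show ?case using g insert finite_mem[of g]
    by (intro bexI[of _ "Set.insert (x, c) g"]) (auto simp: card_insert_if)
qed auto

text \<open>A clique with \<open>Suc (card C)\<close> vertices is small enough to be coloured
  completely by one member of \<open>H\<close>, against the pigeonhole principle. This is the reason
  for demanding \<open>card C < s\<close>.\<close>

lemma card_clique_le:
  assumes "K \<subseteq> V" "finite K" "adjacent_set K"
  shows "card K \<le> card C"
proof (rule ccontr)
  assume "\<not> ?thesis"
  then obtain K' where K': "K' \<subseteq> K" "card K' = Suc (card C)"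
    using obtain_subset_with_card_n[of "Suc (card C)" K] by auto
  have fin: "finite K'" using K' assms finite_subset by blast
  have "K' \<subseteq> V" using K' assms by blast
  then obtain g where g: "g \<in> H" "K' \<subseteq> fst ` g"
    using extend_set[OF fin _ empty_in] K' card_C by auto
  then have "\<forall>v\<in>K'. \<exists>c. (v, c) \<in> g" by fastforce
  then obtain col where col: "\<And>v. v \<in> K' \<Longrightarrow> (v, col v) \<in> g" by metis
  have "inj_on col K'"
  proof (rule inj_onI, rule ccontr)
    fix u v assume *: "u \<in> K'" "v \<in> K'" "col u = col v" "u \<noteq> v"
    then have "E u v" using assms K' unfolding adjacent_set_def by blast
    then show False using proper_mem[OF g(1)] col[of u] col[of v] * unfolding proper_def by fastforce
  qed
  moreover have "col ` K' \<subseteq> C" using col subset_mem[OF g(1)] by blast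
  ultimately have "card K' \<le> card C" using finite_C card_inj_on_le by blast
  then show False using K' by simp
qed

text \<open>If \<open>c\<close> is live at some vertex of \<open>P\<close>, it is given to one with a maximal neighbourhood \<open>Z\<close> in
  \<open>Q\<close>. By maximality and since \<open>G\<close> has no induced \<open>P5\<close>, every vertex of \<open>Q\<close> that still has a
  conflict has a neighbour in \<open>Z\<close>, so that it loses a colour of \<open>M\<close> once a dominating part of \<open>Z\<close> is
  coloured.\<close>

lemma decouple_step:
  assumes f: "f \<in> H" "card f + Suc (ramsey_bound (card C)) \<le> s"
    and PQ: "P \<subseteq> V" "Q \<subseteq> V"
    and t: "\<And>u. u \<in> P \<Longrightarrow> E t u" "\<And>w. w \<in> Q \<Longrightarrow> \<not> E t w"
    and M: "\<And>w. w \<in> Q \<Longrightarrow> live f w = M"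
  shows "\<exists>g\<in>H. f \<subseteq> g \<and> card g \<le> card f + Suc (ramsey_bound (card C)) \<and>
    (\<forall>w\<in>Q. \<forall>u\<in>P. E u w \<longrightarrow> c \<in> live g u \<longrightarrow> c \<in> live g w \<longrightarrow> live g w \<noteq> M)"
proof (cases "\<exists>u\<in>P. c \<in> live f u")
  case False
  then show ?thesis using f by (intro bexI[of _ f]) auto
next
  case True
  let ?N = "\<lambda>v. {w\<in>Q. E v w}"
  let ?P = "{u\<in>P. c \<in> live f u}"
  have finQ: "finite Q" and "finite P" using PQ finite_V by (auto intro: finite_subset)
  then have finP: "finite ?P" by simp
  have "?P \<noteq> {}" using True by blast
  have "Max ((\<lambda>v. card (?N v)) ` ?P) \<in> (\<lambda>v. card (?N v)) ` ?P"
    by (rule Max_in) (use finP \<open>?P \<noteq> {}\<close> in blast)+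
  then obtain v where v: "v \<in> ?P" and vMax: "Max ((\<lambda>v. card (?N v)) ` ?P) = card (?N v)"
    by (rule imageE)
  have vmax: "card (?N u) \<le> card (?N v)" if "u \<in> ?P" for u
    unfolding vMax[symmetric] by (rule Max_ge) (use finP that in auto)
  \<comment> \<open>Giving \<open>c\<close> to \<open>v\<close> removes \<open>c\<close> from all
    neighbours of \<open>v\<close>, so only conflicts between non-neighbours of \<open>v\<close>
    survive. \<open>W\<close> contains their ends in \<open>Q\<close>.\<close>
  define W where "W = {w\<in>Q. \<not> E v w \<and> (\<exists>u\<in>?P. \<not> E u v \<and> E u w)}"
  have tv: "E t v" using v t by blast
  have "\<exists>A\<subseteq>?N v. card A \<le> ramsey_bound (card C) \<and> (\<forall>w\<in>W. \<exists>a\<in>A. E a w)"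
  proof (rule bounded_dominating_subset)
    show "finite (?N v)" using finQ by simp
    show "\<exists>z\<in>?N v. E z w" if "w \<in> W" for w
    proof -
      obtain u where u: "u \<in> ?P" "\<not> E u v" "E u w" using \<open>w \<in> W\<close> W_def by blast
      have w: "w \<in> Q" "\<not> E v w" using that W_def by auto
      \<comment> \<open>As \<open>w\<close> is a neighbour of \<open>u\<close> but not of
        \<open>v\<close>, an inclusion would be proper and contradict the choice of
        \<open>v\<close>. For \<open>z\<close> outside \<open>?N u\<close>, the path
        \<open>z v t u w\<close> then forces the edge between \<open>z\<close> and
        \<open>w\<close>.\<close>
      have "\<not> ?N v \<subseteq> ?N u"
      proof
        assume "?N v \<subseteq> ?N u"
        then have "?N v \<subset> ?N u" using u w by blast
        then have "card (?N v) < card (?N u)" using finQ by (intro psubset_card_mono) auto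
        then show False using vmax[OF u(1)] by simp
      qed
      then obtain z where z: "z \<in> Q" "E v z" "\<not> E u z" by blast
      have "E t u" "\<not> E t z" "\<not> E t w" using t u z w by blast+
      then have "E z w"
        using no_p5[of z v t u w] z u w tv by (auto simp: commute)
      then show ?thesis using z by blast
    qed
    show "card K \<le> card C" if "K \<subseteq> ?N v \<or> K \<subseteq> W" "finite K" "adjacent_set K" for K
      by (rule card_clique_le) (use that PQ W_def in auto)
    show "E a' b'" if "a \<in> ?N v" "b \<in> ?N v" "a' \<in> W" "b' \<in> W" "a \<noteq> b" "\<not> E a b" "E a a'"
      "E b b'" "\<not> E a b'" "\<not> E b a'" for a b a' b'
      using no_p5[of a' a v b b'] that unfolding W_def by (auto simp: commute)
  qed
  then obtain A where A: "A \<subseteq> ?N v" "card A \<le> ramsey_bound (card C)" "\<And>w. w \<in> W \<Longrightarrow> \<exists>a\<in>A. E a w"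
    by blast
  have fv: "insert (v, c) f \<in> H" using v unfolding live_def by blast
  have cfv: "card (insert (v, c) f) \<le> Suc (card f)"
    using finite_mem f by (simp add: card_insert_if)
  have "finite A" "A \<subseteq> V" using A finQ PQ finite_subset[of A Q] by auto
  then obtain g where g: "g \<in> H" "insert (v, c) f \<subseteq> g" "A \<subseteq> fst ` g"
    "card g \<le> card (insert (v, c) f) + card A"
    using extend_set[of A "insert (v, c) f"] fv cfv A(2) f(2) by auto
  have "live g w \<noteq> M" if "w \<in> Q" "u \<in> P" "E u w" "c \<in> live g u" "c \<in> live g w" for u w
  proof -
    have "(v, c) \<in> g" using g by blast
    then have "\<not> E v u" "\<not> E v w" using live_neq that by blast+
    moreover have "c \<in> live f u" using live_antimono[of f g u] g that by blast
    ultimately have "w \<in> W" unfolding W_def using that by (auto simp: commute)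
    then obtain a where a: "a \<in> A" "E a w" using A by blast
    \<comment> \<open>\<open>a\<close> belongs to \<open>Q\<close>, so its colour \<open>b\<close>
      is in \<open>M\<close>; the neighbour \<open>w\<close> of \<open>a\<close> has lost
      it.\<close>
    then obtain b where b: "(a, b) \<in> g" using g by fastforce
    have "b \<in> live g a" using live_mem g b by blast
    then have "b \<in> M" using live_antimono[of f g a] M[of a] a A g by blast
    moreover have "b \<notin> live g w" using live_neq[OF b a(2)] by blast
    ultimately show ?thesis by blast
  qed
  then show ?thesis using g cfv A(2) by (intro bexI[of _ g]) auto
qed

text \<open>A task \<open>(X, Y, M, c)\<close> does not ask for the conflicts on \<open>c\<close> to
  disappear, since \<open>decouple_step\<close> cannot achieve this. It asks that a vertex which
  still has such a conflict no longer has the live set \<open>M\<close>.\<close>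

definition settled :: "nat set \<Rightarrow> (nat \<times> nat) set \<Rightarrow> nat set \<times> nat set \<times> nat set \<times> nat \<Rightarrow> bool" where
  "settled D g = (\<lambda>(X, Y, M, c). \<forall>w\<in>trace_class V D Y. \<forall>u\<in>trace_class V D X.
     E u w \<longrightarrow> c \<in> live g u \<longrightarrow> c \<in> live g w \<longrightarrow> live g w \<noteq> M)"

text \<open>The condition \<open>\<not> X \<subseteq> Y\<close> provides a vertex of
  \<open>D\<close> that sees \<open>u\<close> but not \<open>w\<close>, as
  \<open>decouple_step\<close> needs. Of two distinct traces at least one is not contained in the
  other, so some orientation of every edge between different classes is covered.\<close>

definition decoupled_above :: "nat set \<Rightarrow> (nat \<times> nat) set \<Rightarrow> nat \<Rightarrow> bool" where
  "decoupled_above D g j \<longleftrightarrow> (\<forall>X Y. \<not> X \<subseteq> Y \<longrightarrow> (\<forall>w\<in>trace_class V D Y. card (live g w) > j \<longrightarrow>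
     (\<forall>u\<in>trace_class V D X. E u w \<longrightarrow> live g u \<inter> live g w = {})))"

lemma card_live_mono: "f \<subseteq> g \<Longrightarrow> card (live g w) \<le> card (live f w)"
  using live_antimono live_subset finite_C by (meson card_mono finite_subset)

lemma decoupled_above_mono:
  assumes "decoupled_above D f j" "f \<subseteq> g"
  shows "decoupled_above D g j"
  unfolding decoupled_above_def
proof (intro allI impI ballI)
  fix X Y w u
  assume *: "\<not> X \<subseteq> Y" "w \<in> trace_class V D Y" "j < card (live g w)" "u \<in> trace_class V D X" "E u w"
  then have "j < card (live f w)" using card_live_mono[OF assms(2), of w] by simp
  then have "live f u \<inter> live f w = {}" using assms * unfolding decoupled_above_def by blast
  then show "live g u \<inter> live g w = {}" using live_antimono[OF assms(2)] by blast
qed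

text \<open>If \<open>w\<close> has the live set \<open>M\<close> under \<open>g\<close>, its live
  set under \<open>f\<close> contains \<open>M\<close>. A proper superset was above the threshold,
  so its conflicts were gone already; only the vertices with live set \<open>M\<close> from the
  outset need attention.\<close>

lemma settledI:
  assumes "decoupled_above D f (card M)" "f \<subseteq> g" "\<not> X \<subseteq> Y"
    and "\<And>w u. \<lbrakk>w \<in> trace_class V D Y; live f w = M; u \<in> trace_class V D X; E u w; c \<in> live g u;
      c \<in> live g w\<rbrakk> \<Longrightarrow> live g w \<noteq> M"
  shows "settled D g (X, Y, M, c)"
  unfolding settled_def
proof (clarify)
  fix w u
  assume *: "w \<in> trace_class V D Y" "u \<in> trace_class V D X" "E u w" "c \<in> live g u" "c \<in> live g w"
    "M = live g w"
  show False
  proof (cases "live f w = M")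
    case True
    then show False using assms(4) * by blast
  next
    case False
    then have "M \<subset> live f w" using live_antimono[OF assms(2)] * by blast
    then have "card M < card (live f w)"
      using live_subset finite_C by (meson finite_subset psubset_card_mono)
    then have "live f u \<inter> live f w = {}" using assms(1,3) * unfolding decoupled_above_def by blast
    then show False using live_antimono[OF assms(2)] * by blast
  qed
qed

text \<open>Each task costs one vertex and a Ramsey bound. Later tasks may bring further vertices
  down to the set \<open>M\<close> of an earlier one, but by \<open>settledI\<close> these have no
  conflicts, so earlier tasks stay settled.\<close>

lemma settle_tasks:
  assumes "finite U" "f \<in> H" "decoupled_above D f j" "D \<subseteq> V"
    and "card f + card U * Suc (ramsey_bound (card C)) \<le> s"
    and "\<And>X Y M c. (X, Y, M, c) \<in> U \<Longrightarrow> X \<subseteq> D \<and> \<not> X \<subseteq> Y \<and> card M = j"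
  shows "\<exists>g\<in>H. f \<subseteq> g \<and> card g \<le> card f + card U * Suc (ramsey_bound (card C)) \<and> (\<forall>q\<in>U. settled D g q)"
  using assms
proof (induction U rule: finite_induct)
  case (insert q U)
  obtain X Y M c where q: "q = (X, Y, M, c)" by (cases q) blast
  have U: "X \<subseteq> D \<and> \<not> X \<subseteq> Y \<and> card M = j" if "(X, Y, M, c) \<in> U" for X Y M c
    using insert.prems(5)[of X Y M c] that by simp
  have XY: "X \<subseteq> D" "\<not> X \<subseteq> Y" "card M = j"
    using insert.prems(5)[of X Y M c] q by simp_all
  have le: "card f + card U * Suc (ramsey_bound (card C)) \<le> s"
    using insert.prems(4) insert.hyps by simp
  have "\<exists>g\<in>H. f \<subseteq> g \<and> card g \<le> card f + card U * Suc (ramsey_bound (card C)) \<and> (\<forall>q\<in>U. settled D g q)"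
    by (rule insert.IH[OF insert.prems(1,2,3) le]) (rule U)
  then obtain g where g: "g \<in> H" "f \<subseteq> g" "card g \<le> card f + card U * Suc (ramsey_bound (card C))"
    "\<And>q. q \<in> U \<Longrightarrow> settled D g q"
    by blast
  \<comment> \<open>\<open>t\<close> is adjacent to the whole class of \<open>X\<close> and to
    nothing in the class of \<open>Y\<close>.\<close>
  obtain t where t: "t \<in> X" "t \<notin> Y" "t \<in> D" using XY by blast
  let ?Q = "{w\<in>trace_class V D Y. live g w = M}"
  have "card g + Suc (ramsey_bound (card C)) \<le> s"
    using g(3) insert.prems(4) insert.hyps by simp
  then have "\<exists>g'\<in>H. g \<subseteq> g' \<and> card g' \<le> card g + Suc (ramsey_bound (card C)) \<and>
    (\<forall>w\<in>?Q. \<forall>u\<in>trace_class V D X. E u w \<longrightarrow> c \<in> live g' u \<longrightarrow> c \<in> live g' w \<longrightarrow> live g' w \<noteq> M)"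
    by (intro decouple_step[of g _ ?Q t]) (use g t in \<open>auto simp: trace_class_def\<close>)
  then obtain g' where g': "g' \<in> H" "g \<subseteq> g'" "card g' \<le> card g + Suc (ramsey_bound (card C))"
    "\<And>w u. w \<in> ?Q \<Longrightarrow> u \<in> trace_class V D X \<Longrightarrow> E u w \<Longrightarrow> c \<in> live g' u \<Longrightarrow> c \<in> live g' w \<Longrightarrow> live g' w \<noteq> M"
    by blast
  have dec: "decoupled_above D g j" using decoupled_above_mono insert.prems(2) g by blast
  have "settled D g' q" unfolding q
    by (rule settledI[of D g]) (use dec XY g' in auto)
  moreover have "settled D g' q'" if "q' \<in> U" for q'
  proof -
    obtain X' Y' M' c' where q': "q' = (X', Y', M', c')" by (cases q') blast
    show ?thesis unfolding q'
    proof (rule settledI[of D g])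
      fix w u
      assume *: "w \<in> trace_class V D Y'" "live g w = M'" "u \<in> trace_class V D X'" "E u w"
        "c' \<in> live g' u" "c' \<in> live g' w"
      then have "c' \<in> live g u" "c' \<in> live g w" using live_antimono[OF g'(2)] by blast+
      then show "live g' w \<noteq> M'" using g(4)[OF that] * unfolding settled_def q' by blast
    qed (use dec U that q' g' in auto)
  qed
  ultimately show ?case using g g' insert.hyps by (intro bexI[of _ g']) auto
qed auto

text \<open>At the threshold \<open>card C\<close> there is nothing to show, as live sets are
  contained in \<open>C\<close>. Each round treats the sets just above the new threshold and lowers
  it by one.\<close>

lemma decouple_levels:
  assumes "f \<in> H" "D \<subseteq> V"
    and "card f + i * (4 ^ card D * 2 ^ card C * card C * Suc (ramsey_bound (card C))) \<le> s"
  shows "\<exists>g\<in>H. f \<subseteq> g \<and>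
    card g \<le> card f + i * (4 ^ card D * 2 ^ card C * card C * Suc (ramsey_bound (card C))) \<and>
    decoupled_above D g (card C - i)"
  using assms(3)
proof (induction i)
  case 0
  have "card (live f w) \<le> card C" for w using live_subset finite_C by (simp add: card_mono)
  then have "decoupled_above D f (card C)" unfolding decoupled_above_def by (meson not_le)
  then show ?case using assms by (intro bexI[of _ f]) auto
next
  case step: (Suc i)
  let ?r = "Suc (ramsey_bound (card C))"
  let ?q = "4 ^ card D * 2 ^ card C * card C * ?r"
  from step obtain g where g: "g \<in> H" "f \<subseteq> g" "card g \<le> card f + i * ?q"
    "decoupled_above D g (card C - i)" by auto
  show ?case
  proof (cases "card C - i")
    case 0
    then show ?thesis using g by (intro bexI[of _ g]) auto
  next
    case (Suc j)
    define U where "U = {(X, Y, M, c). X \<subseteq> D \<and> Y \<subseteq> D \<and> M \<subseteq> C \<and> c \<in> C \<and> \<not> X \<subseteq> Y \<and> card M = Suc j}"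
    have finD: "finite D" using assms finite_V finite_subset by blast
    have "U \<subseteq> Pow D \<times> Pow D \<times> Pow C \<times> C" unfolding U_def by blast
    moreover have "finite (Pow D \<times> Pow D \<times> Pow C \<times> C)" using finD finite_C by simp
    ultimately have "finite U" and cU: "card U \<le> card (Pow D \<times> Pow D \<times> Pow C \<times> C)"
      by (rule finite_subset, rule card_mono[rotated])
    \<comment> \<open>The origin of the bound: \<open>4 ^ card D\<close> pairs of traces,
      \<open>2 ^ card C\<close> live sets and \<open>card C\<close> colours.\<close>
    have "card (Pow D \<times> Pow D \<times> Pow C \<times> C) = (2 ^ card D * 2 ^ card D) * 2 ^ card C * card C"
      using finD finite_C by (simp add: card_cartesian_product card_Pow mult.assoc)
    with cU have "card U \<le> 4 ^ card D * 2 ^ card C * card C"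
      by (simp flip: power_mult_distrib)
    then have cU: "card U * ?r \<le> ?q" by (rule mult_right_mono) simp
    have le: "card g + card U * ?r \<le> s" using g(3) cU step.prems by simp
    have "\<exists>g'\<in>H. g \<subseteq> g' \<and> card g' \<le> card g + card U * ?r \<and> (\<forall>q\<in>U. settled D g' q)"
      by (rule settle_tasks[OF \<open>finite U\<close> g(1) g(4)[unfolded Suc] assms(2) le]) (simp add: U_def)
    then obtain g' where g': "g' \<in> H" "g \<subseteq> g'" "card g' \<le> card g + card U * ?r"
      "\<And>q. q \<in> U \<Longrightarrow> settled D g' q"
      by blast
    have dec: "decoupled_above D g' (Suc j)" using decoupled_above_mono g g' Suc by metis
    have "decoupled_above D g' j" unfolding decoupled_above_def
    proof (intro allI impI ballI)
      fix X Y w u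
      assume *: "\<not> X \<subseteq> Y" "w \<in> trace_class V D Y" "j < card (live g' w)" "u \<in> trace_class V D X" "E u w"
      show "live g' u \<inter> live g' w = {}"
      proof (cases "Suc j < card (live g' w)")
        case True
        then show ?thesis using dec * unfolding decoupled_above_def by blast
      next
        case False
        \<comment> \<open>The task whose third component is \<open>live g' w\<close> itself is
          settled. Its escape, a different live set, is void, so no common colour can
          remain.\<close>
        then have "card (live g' w) = Suc j" using * by simp
        moreover have "X \<subseteq> D" "Y \<subseteq> D" using * unfolding trace_class_def by auto
        moreover have "c \<in> C" if "c \<in> live g' w" for c using that live_subset by blast
        ultimately have "settled D g' (X, Y, live g' w, c)" if "c \<in> live g' w" for c
          using *(1) that live_subset[of g' w] by (intro g'(4)) (simp add: U_def)
        then show ?thesis using *(2,4,5) unfolding settled_def by fastforce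
      qed
    qed
    moreover have "card C - Suc i = j" using Suc by simp
    ultimately show ?thesis using g g' cU by (intro bexI[of _ g']) auto
  qed
qed

end

text \<open>The summands pay for colouring a dominating set of at most \<open>d\<close> vertices,
  for \<open>Suc m\<close> rounds of decoupling, for the classes with one colour less, and for
  exceeding the number of colours. With no colours, a single extension step already refutes a
  nonempty graph.\<close>

fun width :: "nat \<Rightarrow> nat" where
  "width 0 = 1"
| "width (Suc m) = (let R = ramsey_bound (Suc m); d = 1 + 2 * R in
     d + Suc m * (4 ^ d * 2 ^ Suc m * Suc m * Suc R) + width m + Suc (Suc m))"

section \<open>Colouring a graph from a consistent family\<close>

context p5_free_graph
begin

text \<open>The classes are coloured independently of each other. That the results fit rests on all
  their colours being live for the same member \<open>g\<close>, which admits no conflict between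
  different classes.\<close>

lemma colouring_dominated:
  assumes IH: "\<And>V C H. \<lbrakk>finite V; finite C; card C = m; consistent s' V C H\<rbrakk> \<Longrightarrow> \<exists>col. colouring_from V H col"
    and fin: "finite V" "finite C" and C: "card C = Suc m" and cons: "consistent s V C H"
    and D: "D \<subseteq> V" "card D \<le> d" "\<And>v. v \<in> V - D \<Longrightarrow> \<exists>x\<in>D. E x v"
    and s: "d + Suc m * (4 ^ d * 2 ^ Suc m * Suc m * Suc (ramsey_bound (Suc m))) + s' + Suc (Suc m) \<le> s"
  shows "\<exists>col. colouring_from V H col"
proof -
  interpret consistent_family E s V C H
    by unfold_locales (use fin cons C s in auto)
  have finD: "finite D" using D fin finite_subset by blast
  have "card D \<le> s" using D s by simp
  then obtain f where f: "f \<in> H" "D \<subseteq> fst ` f" "card f \<le> card D"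
    using extend_set[OF finD D(1) empty_in] by auto
  let ?b = "\<lambda>e. Suc m * (4 ^ e * 2 ^ Suc m * Suc m * Suc (ramsey_bound (Suc m)))"
  have b: "?b (card D) \<le> ?b d"
    by (intro mult_le_mono order_refl power_increasing D) simp
  have le: "card f + ?b (card D) \<le> s" and le': "card f + ?b (card D) \<le> d + ?b d"
    using b f(3) D(2) s by linarith+
  obtain g where g: "g \<in> H" "f \<subseteq> g" "card g \<le> card f + ?b (card D)" "decoupled_above D g 0"
    using decouple_levels[OF f(1) D(1), of "card C", unfolded C, OF le] by auto
  have card_g: "card g \<le> d + ?b d" using g(3) le' by (rule le_trans)
  have "\<forall>x\<in>D. \<exists>a. (x, a) \<in> g" using f(2) g(2) by fastforce
  then obtain dcol where dcol: "\<And>x. x \<in> D \<Longrightarrow> (x, dcol x) \<in> g" by metis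
  let ?K = "\<lambda>X. trace_class V D X - D"
  \<comment> \<open>A singleton belongs to this family only if its colour is live for
    \<open>g\<close>. Since \<open>g\<close> is small compared with \<open>s\<close>, the family is
    still \<open>s'\<close>-consistent.\<close>
  let ?H = "\<lambda>X. {h. h \<union> g \<in> H \<and> h \<subseteq> ?K X \<times> UNIV}"
  have "\<exists>col. colouring_from (?K X) (?H X) col" for X
  \<comment> \<open>Outside \<open>D\<close> every vertex has a neighbour in \<open>D\<close>, so
    only a nonempty trace needs a colour to be removed.\<close>
  proof (cases "\<exists>x. x \<in> X \<and> x \<in> D")
    case False
    then have "?K X = {}" using D(3) unfolding trace_class_def by fastforce
    then show ?thesis unfolding colouring_from_def by (metis empty_iff)
  next
    case True
    then obtain x where x: "x \<in> X" "x \<in> D" by blast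
    have xK: "E x v" if "v \<in> ?K X" for v using that x unfolding trace_class_def by blast
    have KV: "?K X \<subseteq> V" unfolding trace_class_def by blast
    have xC: "dcol x \<in> C" using dcol[OF x(2)] subset_mem[OF g(1)] by blast
    show ?thesis
    proof (rule IH)
      show "finite (?K X)" using KV fin finite_subset by blast
      show "finite (C - {dcol x})" using fin by simp
      show "card (C - {dcol x}) = m" using xC C fin by simp
      have H1: "h \<subseteq> ?K X \<times> (C - {dcol x})" if h: "h \<in> ?H X" for h
      proof (rule subrelI)
        fix v c assume vc: "(v, c) \<in> h"
        have hg: "h \<union> g \<in> H" using h by simp
        have vK: "v \<in> ?K X" using h vc by blast
        have "c \<in> C" using subset_mem[OF hg] vc by blast
        moreover have "dcol x \<noteq> c"
        proof -
          have "(x, dcol x) \<in> h \<union> g" "(v, c) \<in> h \<union> g" using dcol[OF x(2)] vc by blast+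
          then show ?thesis using proper_mem[OF hg] xK[OF vK] unfolding proper_def by blast
        qed
        ultimately show "(v, c) \<in> ?K X \<times> (C - {dcol x})" using vK by simp
      qed
      have H2: "\<exists>c. insert (v, c) h \<in> ?H X" if h: "h \<in> ?H X" "card h < s'" "v \<in> ?K X" for h v
      proof -
        have "card (h \<union> g) < s" using card_Un_le[of h g] h(2) card_g s by linarith
        then obtain c where "insert (v, c) (h \<union> g) \<in> H" using extend[of "h \<union> g" v] h KV by blast
        then show ?thesis using h by auto
      qed
      have H3: "h' \<in> ?H X" if "h \<in> ?H X" "h' \<subseteq> h" for h h'
        using that down[of "h \<union> g" "h' \<union> g"] by auto
      have H4: "finite h \<and> proper h" if "h \<in> ?H X" for h
        using that down[of "h \<union> g" h] finite_mem[of h] proper_mem[of h] by auto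
      have "{} \<in> ?H X" using g by simp
      then show "consistent s' (?K X) (C - {dcol x}) (?H X)"
        unfolding consistent_def
        by (intro conjI ballI allI impI)
          (assumption | erule (2) H2 | erule (1) H3 | erule H1 | erule H4[THEN conjunct1] | erule H4[THEN conjunct2])+
    qed
  qed
  then have "\<forall>X. \<exists>col. colouring_from (?K X) (?H X) col" by (rule allI)
  from choice[OF this] obtain kcol where "\<forall>X. colouring_from (?K X) (?H X) (kcol X)" ..
  then have kcol: "colouring_from (?K X) (?H X) (kcol X)" for X by (rule spec)
  define tr where "tr v = {x\<in>D. E x v}" for v
  have tr: "v \<in> ?K (tr v)" if "v \<in> V - D" for v using that unfolding trace_class_def tr_def by blast
  define col where "col v = (if v \<in> D then dcol v else kcol (tr v) v)" for v
  have live: "col v \<in> live g v" if "v \<in> V" for v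
  proof (cases "v \<in> D")
    case True
    then show ?thesis using live_mem[OF g(1) dcol] by (simp add: col_def)
  next
    case False
    then show ?thesis using kcol[of "tr v"] tr[of v] that unfolding colouring_from_def live_def col_def by simp
  qed
  \<comment> \<open>\<open>decoupled_above\<close> treats one orientation of an edge; the other
    cases follow by exchanging \<open>u\<close> and \<open>v\<close>.\<close>
  have sym_case: "col u \<noteq> col v" if uv: "u \<in> V" "v \<in> V" "E u v" "u \<in> D \<or> u \<notin> D \<and> v \<notin> D \<and> tr u = tr v
     \<or> u \<notin> D \<and> v \<notin> D \<and> \<not> tr u \<subseteq> tr v" for u v
    using uv(4)
  proof (elim disjE conjE)
    assume "u \<in> D"
    then have "(u, col u) \<in> g" using dcol by (simp add: col_def)
    then show ?thesis using live_neq[OF _ uv(3) live[OF uv(2)]] by metis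
  next
    assume *: "u \<notin> D" "v \<notin> D" "tr u = tr v"
    then have "u \<in> ?K (tr u)" "v \<in> ?K (tr u)" using tr[of u] tr[of v] uv by auto
    then show ?thesis using kcol[of "tr u"] uv(3) * unfolding colouring_from_def col_def by simp
  next
    assume *: "u \<notin> D" "v \<notin> D" "\<not> tr u \<subseteq> tr v"
    have "u \<in> trace_class V D (tr u)" "v \<in> trace_class V D (tr v)" using tr[of u] tr[of v] uv * by auto
    moreover have "card (live g v) > 0"
      using live[OF uv(2)] finite_subset[OF live_subset fin(2)] by (auto simp: card_gt_0_iff)
    ultimately have "live g u \<inter> live g v = {}"
      using g(4) *(3) uv(3) unfolding decoupled_above_def by blast
    then show ?thesis using live[OF uv(1)] live[OF uv(2)] by auto
  qed
  have "col u \<noteq> col v" if uv: "u \<in> V" "v \<in> V" "E u v" for u v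
  proof (cases "u \<in> D \<or> u \<notin> D \<and> v \<notin> D \<and> tr u = tr v \<or> u \<notin> D \<and> v \<notin> D \<and> \<not> tr u \<subseteq> tr v")
    case True
    then show ?thesis using sym_case[OF uv] by blast
  next
    case False
    then have "v \<in> D \<or> v \<notin> D \<and> u \<notin> D \<and> \<not> tr v \<subseteq> tr u" by blast
    then show ?thesis using sym_case[OF uv(2,1) sym[OF uv(3)]] by metis
  qed
  moreover have "{(v, col v)} \<in> H" if "v \<in> V" for v
    using live[OF that] down[of "insert (v, col v) g" "{(v, col v)}"] unfolding live_def by simp
  ultimately show ?thesis unfolding colouring_from_def by blast
qed

text \<open>Bounded dominating sets exist only for components, hence the inner induction on
  \<open>V\<close>, which splits off one component at a time. By \<open>consistent_subset\<close>
  this costs neither colours nor width.\<close>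

lemma colouring_exists:
  assumes "finite V" "finite C" "card C = m" "consistent (width m) V C H"
  shows "\<exists>col. colouring_from V H col"
  using assms
proof (induction m arbitrary: V C H)
  case 0
  then have "C = {}" by simp
  have "V = {}"
  proof (rule ccontr)
    assume "V \<noteq> {}"
    then obtain v c where "{(v, c)} \<in> H"
      using 0(4) unfolding consistent_def by fastforce
    then show False using 0(4) \<open>C = {}\<close> unfolding consistent_def by blast
  qed
  then show ?case unfolding colouring_from_def by simp
next
  case (Suc m)
  note IH = Suc.IH
  from Suc.prems(1,2,3,4) show ?case
  proof (induction V arbitrary: H rule: finite_psubset_induct)
    case (psubset V)
    show ?case
    proof (cases "V = {}")
      case True
      then show ?thesis unfolding colouring_from_def by simp
    next
      case False
      then obtain v0 where v0: "v0 \<in> V" by blast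
      interpret consistent_family E "width (Suc m)" V C H
        by unfold_locales (use psubset in \<open>auto simp: Let_def\<close>)
      obtain S D where S: "v0 \<in> S" "S \<subseteq> V" "closed_within V S" "D \<subseteq> S"
        "card D \<le> 1 + 2 * ramsey_bound (Suc m)" "\<And>v. v \<in> S - D \<Longrightarrow> \<exists>x\<in>D. E x v"
        using bounded_domination[OF psubset.hyps v0, of "card C"] card_clique_le psubset.prems(2) by metis
      have "\<exists>col. colouring_from S {f\<in>H. f \<subseteq> S \<times> UNIV} col"
      proof (rule colouring_dominated)
        show "\<exists>col. colouring_from V H col"
          if "finite V" "finite C" "card C = m" "consistent (width m) V C H" for V C H
          by (rule IH) (fact that)+
        show "consistent (width (Suc m)) S C {f\<in>H. f \<subseteq> S \<times> UNIV}"
          by (rule consistent_subset[OF psubset.prems(3) S(2)])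
        show "finite S" using S psubset.hyps finite_subset by blast
        show "\<And>v. v \<in> S - D \<Longrightarrow> \<exists>x\<in>D. E x v" by (rule S(6))
        show "(1 + 2 * ramsey_bound (Suc m)) + Suc m * (4 ^ (1 + 2 * ramsey_bound (Suc m)) *
          2 ^ Suc m * Suc m * Suc (ramsey_bound (Suc m))) + width m + Suc (Suc m) \<le> width (Suc m)"
          by (simp only: width.simps Let_def order_refl)
      qed (fact psubset.prems S)+
      then obtain c1 where c1: "colouring_from S {f\<in>H. f \<subseteq> S \<times> UNIV} c1" by blast
      have "\<exists>col. colouring_from (V - S) {f\<in>H. f \<subseteq> (V - S) \<times> UNIV} col"
      proof (rule psubset.IH)
        show "V - S \<subset> V" using v0 S by blast
        show "consistent (width (Suc m)) (V - S) C {f\<in>H. f \<subseteq> (V - S) \<times> UNIV}"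
          by (rule consistent_subset[OF psubset.prems(3)]) blast
      qed (use psubset.prems in auto)
      then obtain c2 where c2: "colouring_from (V - S) {f\<in>H. f \<subseteq> (V - S) \<times> UNIV} c2" by blast
      have "u \<in> S \<longleftrightarrow> v \<in> S" if "u \<in> V" "v \<in> V" "E u v" for u v
        using that S(3) sym unfolding closed_within_def by blast
      then have "colouring_from V H (\<lambda>v. if v \<in> S then c1 v else c2 v)"
        using c1 c2 S(2) unfolding colouring_from_def by auto
      then show ?thesis by blast
    qed
  qed
qed

end

section \<open>Programs for random access machines\<close>

type_synonym code = "nat \<Rightarrow> instr list"

text \<open>A code fragment is a function of the address at which it is placed.\<close>

definition runs :: "code \<Rightarrow> bool list \<Rightarrow> (nat \<Rightarrow> nat) \<Rightarrow> bool list \<Rightarrow> (nat \<Rightarrow> nat) \<Rightarrow> nat \<Rightarrow> bool" where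
  "runs c w X w' X' t \<longleftrightarrow> (\<forall>pre post. (step (pre @ c (length pre) @ post) ^^ t) (length pre, w, X) =
     (length pre + length (c (length pre)), w', X'))"

text \<open>Termination and a time bound are part of the triple, and through \<open>runs\<close>
  they hold inside any surrounding program.\<close>

definition hoare :: "code \<Rightarrow> (bool list \<Rightarrow> (nat \<Rightarrow> nat) \<Rightarrow> bool) \<Rightarrow> nat \<Rightarrow>
    (bool list \<Rightarrow> (nat \<Rightarrow> nat) \<Rightarrow> bool) \<Rightarrow> bool" where
  "hoare c P T Q \<longleftrightarrow> (\<forall>w X. P w X \<longrightarrow> (\<exists>t\<le>T. \<exists>w' X'. runs c w X w' X' t \<and> Q w' X'))"

lemma hoareD:
  assumes "hoare c P T Q" "P w X"
  shows "\<exists>t w' X'. t \<le> T \<and> runs c w X w' X' t \<and> Q w' X'"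
  using assms unfolding hoare_def by blast

definition seq :: "code \<Rightarrow> code \<Rightarrow> code" where
  "seq c d = (\<lambda>a. c a @ d (a + length (c a)))"

text \<open>The test follows the body, so every loop runs at least once. This is the source of
  \<open>0 < n\<close> below and of \<open>B \<sigma> > 0\<close> in
  \<open>computes\<close>.\<close>

definition do_while :: "nat \<Rightarrow> code \<Rightarrow> code" where
  "do_while r c = (\<lambda>a. c a @ [JumpPos r a])"

lemma runs_seq:
  assumes "runs c w X w' X' t" "runs d w' X' w'' X'' t'"
  shows "runs (seq c d) w X w'' X'' (t' + t)"
  unfolding runs_def
proof (intro allI)
  fix pre post :: "instr list"
  let ?a = "length pre" let ?c = "c ?a" let ?d = "d (?a + length ?c)"
  have "(step (pre @ ?c @ ?d @ post) ^^ t) (?a, w, X) = (?a + length ?c, w', X')"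
    using assms(1) unfolding runs_def by blast
  moreover have "(step ((pre @ ?c) @ d (length (pre @ ?c)) @ post) ^^ t') (length (pre @ ?c), w', X') =
      (length (pre @ ?c) + length (d (length (pre @ ?c))), w'', X'')"
    using assms(2) unfolding runs_def by blast
  ultimately show "(step (pre @ seq c d ?a @ post) ^^ (t' + t)) (?a, w, X) =
      (?a + length (seq c d ?a), w'', X'')"
    by (simp add: seq_def funpow_add)
qed

lemma hoare_seq:
  assumes "hoare c P T Q" "hoare d Q T' R"
  shows "hoare (seq c d) P (T + T') R"
  unfolding hoare_def
proof (intro allI impI)
  fix w X assume "P w X"
  then obtain t w' X' where 1: "t \<le> T" "runs c w X w' X' t" "Q w' X'"
    using assms(1) unfolding hoare_def by blast
  then obtain t' w'' X'' where 2: "t' \<le> T'" "runs d w' X' w'' X'' t'" "R w'' X''"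
    using assms(2) unfolding hoare_def by blast
  show "\<exists>t\<le>T + T'. \<exists>w' X'. runs (seq c d) w X w' X' t \<and> R w' X'"
    using runs_seq[OF 1(2) 2(2)] 1 2 by (intro exI[of _ "t' + t"]) auto
qed

lemma hoare_conseq:
  assumes "hoare c P T Q" "\<And>w X. P' w X \<Longrightarrow> P w X" "T \<le> T'" "\<And>w X. Q w X \<Longrightarrow> Q' w X"
  shows "hoare c P' T' Q'"
  using assms unfolding hoare_def by (meson le_trans)

fun no_jump :: "instr \<Rightarrow> bool" where
  "no_jump (JumpPos i a) = False"
| "no_jump _ = True"

abbreviation effect :: "instr list \<Rightarrow> bool list \<times> (nat \<Rightarrow> nat) \<Rightarrow> bool list \<times> (nat \<Rightarrow> nat)" where
  "effect \<equiv> fold (\<lambda>i s. snd (exec i (0, s)))"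

lemma exec_no_jump: "no_jump i \<Longrightarrow> exec i (pc, s) = (Suc pc, snd (exec i (0, s)))"
  by (cases "(i, (pc, s))" rule: exec.cases) auto

lemma runs_straight:
  assumes "\<forall>i\<in>set is. no_jump i"
  shows "runs (\<lambda>_. is) w X (fst (effect is (w, X))) (snd (effect is (w, X))) (length is)"
  unfolding runs_def
proof (intro allI)
  fix pre post :: "instr list"
  show "(step (pre @ is @ post) ^^ length is) (length pre, w, X) =
      (length pre + length is, fst (effect is (w, X)), snd (effect is (w, X)))"
    using assms
  proof (induction "is" arbitrary: pre w X)
    case (Cons i js)
    obtain w' X' where wX: "snd (exec i (0, w, X)) = (w', X')" by fastforce
    have "step (pre @ (i # js) @ post) (length pre, w, X) = (Suc (length pre), w', X')"
      using Cons.prems exec_no_jump[of i "length pre" "(w, X)"] wX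
      by (simp add: step_def halted_def nth_append)
    moreover have "(step ((pre @ [i]) @ js @ post) ^^ length js) (length (pre @ [i]), w', X') =
      (length (pre @ [i]) + length js, fst (effect js (w', X')), snd (effect js (w', X')))"
      using Cons.IH[of "pre @ [i]" w' X'] Cons.prems by simp
    ultimately show ?case using wX
      by (simp add: funpow_swap1 del: funpow.simps add: funpow_Suc_right)
  qed simp
qed

lemma hoare_straight:
  assumes "\<forall>i\<in>set is. no_jump i"
    and "\<And>w X. P w X \<Longrightarrow> Q (fst (effect is (w, X))) (snd (effect is (w, X)))"
  shows "hoare (\<lambda>_. is) P (length is) Q"
  using runs_straight[OF assms(1)] assms(2) unfolding hoare_def by blast

text \<open>The body has to report in register \<open>r\<close> whether another round is due, so
  there are exactly \<open>n\<close> rounds. \<open>Suc T\<close> includes the jump.\<close>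

lemma hoare_do_while:
  assumes body: "\<And>i. i < n \<Longrightarrow>
      hoare c (Inv i) T (\<lambda>w X. Inv (Suc i) w X \<and> (X r > 0 \<longleftrightarrow> Suc i < n))"
    and "0 < n"
  shows "hoare (do_while r c) (Inv 0) (n * Suc T) (Inv n)"
proof -
  \<comment> \<open>\<open>m\<close> counts the rounds that are left, whence the index
    \<open>n - m\<close> of the invariant.\<close>
  have "\<exists>t\<le>m * Suc T. \<exists>w' X'. runs (do_while r c) w X w' X' t \<and> Inv n w' X'"
    if "Inv (n - m) w X" "0 < m" "m \<le> n" for m w X
    using that
  proof (induction m arbitrary: w X)
    case (Suc m)
    have less: "n - Suc m < n" using Suc.prems(3) by simp
    obtain t w' X' where 1: "t \<le> T" "runs c w X w' X' t" "Inv (Suc (n - Suc m)) w' X'"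
      "X' r > 0 \<longleftrightarrow> Suc (n - Suc m) < n"
      using hoareD[OF body[OF less], OF Suc.prems(1)] by (elim exE conjE)
    have idx: "Suc (n - Suc m) = n - m" using Suc.prems by simp
    have one: "(step (pre @ do_while r c (length pre) @ post) ^^ Suc t) (length pre, w, X) =
        (if X' r > 0 then length pre else Suc (length pre + length (c (length pre))), w', X')" for pre post
    proof -
      have "(step (pre @ c (length pre) @ JumpPos r (length pre) # post) ^^ t) (length pre, w, X) =
        (length pre + length (c (length pre)), w', X')"
        using 1(2) unfolding runs_def by blast
      then show ?thesis by (simp add: do_while_def step_def halted_def nth_append)
    qed
    show ?case
    proof (cases m)
      case 0
      then have "\<not> X' r > 0" using 1(4) idx by simp
      then have "runs (do_while r c) w X w' X' (Suc t)"
        unfolding runs_def using one by (simp add: do_while_def)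
      then show ?thesis using 1 idx 0 by (intro exI[of _ "Suc t"]) auto
    next
      case m: (Suc _)
      then have pos: "X' r > 0" using 1(4) idx Suc.prems by simp
      obtain t' w'' X'' where 2: "t' \<le> m * Suc T" "runs (do_while r c) w' X' w'' X'' t'" "Inv n w'' X''"
        using Suc.IH[of w' X'] 1(3) idx m Suc.prems by auto
      have "runs (do_while r c) w X w'' X'' (t' + Suc t)"
        unfolding runs_def funpow_add comp_apply one using pos 2(2) by (simp add: runs_def)
      then show ?thesis using 1 2 by (intro exI[of _ "t' + Suc t"]) auto
    qed
  qed simp
  then show ?thesis using \<open>0 < n\<close> unfolding hoare_def by (metis diff_self_eq_0 le_refl)
qed

text \<open>Even registers hold the memory, odd registers the variables; register 1 holds the common bound
  \<open>B\<close> of all loops. Code that computes a function uses only the variables from some number \<open>s\<close> on.\<close>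

definition agree :: "nat \<Rightarrow> (nat \<Rightarrow> nat) \<Rightarrow> (nat \<Rightarrow> nat) \<Rightarrow> bool" where
  "agree s X Y \<longleftrightarrow> (\<forall>r. even r \<or> r < 2 * s \<longrightarrow> Y r = X r)"

definition represents :: "(nat \<Rightarrow> nat) \<Rightarrow> nat \<Rightarrow> nat list \<Rightarrow> nat list \<Rightarrow> (nat \<Rightarrow> nat) \<Rightarrow> bool" where
  "represents m b xs ls X \<longleftrightarrow> (\<forall>a. X (2 * a) = m a) \<and> X 1 = b \<and> map (\<lambda>l. X (2 * l + 1)) ls = xs"

lemma agree_trans: "agree s X Y \<Longrightarrow> agree s Y Z \<Longrightarrow> agree s X Z"
  and agree_mono: "agree s' X Y \<Longrightarrow> s \<le> s' \<Longrightarrow> agree s X Y"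
  and agree_upd: "agree s X Y \<Longrightarrow> s \<le> j \<Longrightarrow> agree s X (Y(2 * j + 1 := v))"
  unfolding agree_def by auto

lemma agree_nth: "agree s X Y \<Longrightarrow> j < s \<Longrightarrow> Y (2 * j + 1) = X (2 * j + 1)"
  and agree_even: "agree s X Y \<Longrightarrow> Y (2 * a) = X (2 * a)"
  unfolding agree_def by auto

lemma represents_agree:
  assumes "represents m b xs ls X" "agree s X Y" "0 < s" "\<forall>l\<in>set ls. l < s"
  shows "represents m b xs ls Y"
proof -
  have "Y (2 * l + 1) = X (2 * l + 1)" if "l \<in> set ls" for l
    using agree_nth[OF assms(2)] assms(4) that by blast
  moreover have "Y 1 = X 1" using agree_nth[OF assms(2,3)] by simp
  ultimately show ?thesis
    using assms(1) agree_even[OF assms(2)] unfolding represents_def by auto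
qed

text \<open>The variables \<open>vs\<close> are found in the slots \<open>ls\<close>, the slots from
  \<open>s\<close> on are free, and slot \<open>s\<close> receives the value. Bounds of the form
  \<open>(B \<sigma> + 2) ^ K\<close> absorb constants, sums and a factor \<open>B \<sigma>\<close>
  by raising \<open>K\<close>, which does not depend on \<open>\<sigma>\<close>.\<close>

definition computes :: "('s \<Rightarrow> nat \<Rightarrow> nat) \<Rightarrow> ('s \<Rightarrow> nat) \<Rightarrow> ('s \<Rightarrow> nat) list \<Rightarrow> nat list \<Rightarrow> nat \<Rightarrow>
    ('s \<Rightarrow> nat) \<Rightarrow> code \<Rightarrow> nat \<Rightarrow> bool" where
  "computes mem B vs ls s F c K \<longleftrightarrow>
     (\<forall>\<sigma> X0. B \<sigma> > 0 \<longrightarrow> represents (mem \<sigma>) (B \<sigma>) (map (\<lambda>v. v \<sigma>) vs) ls X0 \<longrightarrow>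
        hoare c (\<lambda>w X. w = [] \<and> X = X0) ((B \<sigma> + 2) ^ K)
          (\<lambda>w X. w = [] \<and> X (2 * s + 1) = F \<sigma> \<and> agree s X0 X))"

text \<open>All placements are allowed so that a function can also be evaluated inside larger
  expressions and loops, where fewer slots are free.\<close>

definition computable :: "('s \<Rightarrow> nat \<Rightarrow> nat) \<Rightarrow> ('s \<Rightarrow> nat) \<Rightarrow> ('s \<Rightarrow> nat) list \<Rightarrow> ('s \<Rightarrow> nat) \<Rightarrow> bool" where
  "computable mem B vs F \<longleftrightarrow> (\<forall>ls s. length ls = length vs \<longrightarrow> 0 < s \<longrightarrow> (\<forall>l\<in>set ls. l < s) \<longrightarrow>
     (\<exists>c K. computes mem B vs ls s F c K))"

lemma computableI:
  assumes "\<And>ls s. \<lbrakk>length ls = length vs; 0 < s; \<forall>l\<in>set ls. l < s\<rbrakk> \<Longrightarrow> \<exists>c K. computes mem B vs ls s F c K"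
  shows "computable mem B vs F"
  unfolding computable_def by (intro allI impI) (rule assms)

lemma computesI:
  assumes "\<And>\<sigma> X0. \<lbrakk>B \<sigma> > 0; represents (mem \<sigma>) (B \<sigma>) (map (\<lambda>v. v \<sigma>) vs) ls X0\<rbrakk> \<Longrightarrow>
     hoare c (\<lambda>w X. w = [] \<and> X = X0) ((B \<sigma> + 2) ^ K)
       (\<lambda>w X. w = [] \<and> X (2 * s + 1) = F \<sigma> \<and> agree s X0 X)"
  shows "\<exists>c K. computes mem B vs ls s F c K"
  by (rule exI[of _ c], rule exI[of _ K], unfold computes_def, intro allI impI) (rule assms)

lemma computesD:
  assumes "computes mem B vs ls s F c K" "B \<sigma> > 0" "represents (mem \<sigma>) (B \<sigma>) (map (\<lambda>v. v \<sigma>) vs) ls X0"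
  shows "hoare c (\<lambda>w X. w = [] \<and> X = X0) ((B \<sigma> + 2) ^ K)
     (\<lambda>w X. w = [] \<and> X (2 * s + 1) = F \<sigma> \<and> agree s X0 X)"
  using assms unfolding computes_def by blast

lemma computableE:
  assumes "computable mem B vs F" "length ls = length vs" "0 < s" "\<forall>l\<in>set ls. l < s"
  obtains c K where "computes mem B vs ls s F c K"
  using assms unfolding computable_def by blast

lemma le_two_power: "n \<le> (2::nat) ^ n"
  by (rule less_imp_le) (rule less_exp)

lemma const_le_power: "n \<le> (b + 2 :: nat) ^ n"
  using le_two_power[of n] power_mono[of 2 "b + 2" n] by simp

lemma add_power_le: "(b + 2 :: nat) ^ i + (b + 2) ^ j \<le> (b + 2) ^ (i + j + 1)"
proof -
  have "(b + 2) ^ i \<le> (b + 2 :: nat) ^ (i + j)" "(b + 2) ^ j \<le> (b + 2 :: nat) ^ (i + j)"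
    by (rule power_increasing; simp)+
  then have "(b + 2) ^ i + (b + 2) ^ j \<le> 2 * (b + 2) ^ (i + j)" by linarith
  also have "\<dots> \<le> (b + 2) * (b + 2) ^ (i + j)" by (rule mult_le_mono1) simp
  finally show ?thesis by simp
qed

lemma add_const_power_le: "(b + 2 :: nat) ^ i + n \<le> (b + 2) ^ (i + n + 1)"
  using add_power_le[of b i n] const_le_power[of n b] by linarith

lemma computable_const: "computable mem B vs (\<lambda>_. k)"
proof (rule computableI)
  fix ls :: "nat list" and s :: nat
  have *: "hoare (\<lambda>_. [SetConst (2 * s + 1) k]) (\<lambda>w X. w = [] \<and> X = X0) ((b + 2) ^ 1)
        (\<lambda>w X. w = [] \<and> X (2 * s + 1) = k \<and> agree s X0 X)" for X0 and b :: nat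
    by (rule hoare_conseq[OF hoare_straight[where P = "\<lambda>w X. w = [] \<and> X = X0"
            and Q = "\<lambda>w X. w = [] \<and> X (2 * s + 1) = k \<and> agree s X0 X"]])
      (auto simp: agree_def)
  show "\<exists>c K. computes mem B vs ls s (\<lambda>_. k) c K" by (rule computesI, rule *)
qed

lemma computable_bound: "computable mem B vs B"
proof (rule computableI)
  fix ls :: "nat list" and s :: nat
  assume "0 < s"
  have *: "hoare (\<lambda>_. [SetConst (2 * s + 1) 0, Add (2 * s + 1) (2 * s + 1) 1]) (\<lambda>w X. w = [] \<and> X = X0) ((b + 2) ^ 1)
        (\<lambda>w X. w = [] \<and> X (2 * s + 1) = b \<and> agree s X0 X)" if "X0 1 = b" for X0 b
    by (rule hoare_conseq[OF hoare_straight[where P = "\<lambda>w X. w = [] \<and> X = X0"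
            and Q = "\<lambda>w X. w = [] \<and> X (2 * s + 1) = b \<and> agree s X0 X"]])
      (use that \<open>0 < s\<close> in \<open>auto simp: agree_def\<close>)
  show "\<exists>c K. computes mem B vs ls s B c K" by (rule computesI, rule *) (simp add: represents_def)
qed

lemma computable_var:
  assumes "v \<in> set vs"
  shows "computable mem B vs v"
proof (rule computableI)
  fix ls :: "nat list" and s :: nat
  assume ls: "length ls = length vs" "0 < s" "\<forall>l\<in>set ls. l < s"
  obtain i where i: "i < length vs" "vs ! i = v" using assms by (metis in_set_conv_nth)
  have less: "ls ! i < s" using ls i by simp
  have *: "hoare (\<lambda>_. [SetConst (2 * s + 1) 0, Add (2 * s + 1) (2 * s + 1) (2 * (ls ! i) + 1)])
        (\<lambda>w X. w = [] \<and> X = X0) ((b + 2) ^ 1)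
        (\<lambda>w X. w = [] \<and> X (2 * s + 1) = a \<and> agree s X0 X)" if "X0 (2 * (ls ! i) + 1) = a" for X0 a and b :: nat
    by (rule hoare_conseq[OF hoare_straight[where P = "\<lambda>w X. w = [] \<and> X = X0"
            and Q = "\<lambda>w X. w = [] \<and> X (2 * s + 1) = a \<and> agree s X0 X"]])
      (use that less in \<open>auto simp: agree_def\<close>)
  have **: "X0 (2 * (ls ! i) + 1) = v \<sigma>"
    if "represents (mem \<sigma>) (B \<sigma>) (map (\<lambda>v. v \<sigma>) vs) ls X0" for \<sigma> X0
  proof -
    have "map (\<lambda>l. X0 (2 * l + 1)) ls ! i = map (\<lambda>v. v \<sigma>) vs ! i"
      using that unfolding represents_def by simp
    then show ?thesis using i ls by simp
  qed
  show "\<exists>c K. computes mem B vs ls s v c K" by (rule computesI, rule *, rule **)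
qed

lemma computable_binop:
  assumes F: "computable mem B vs F" and G: "computable mem B vs G"
    and ins: "\<And>i j. no_jump (ins i i j)" "\<And>i j w X. exec (ins i i j) (0, w, X) = (1, w, X(i := f (X i) (X j)))"
  shows "computable mem B vs (\<lambda>\<sigma>. f (F \<sigma>) (G \<sigma>))"
proof (rule computableI)
  fix ls :: "nat list" and s :: nat
  assume ls: "length ls = length vs" "0 < s" "\<forall>l\<in>set ls. l < s"
  obtain c K where "computes mem B vs ls s F c K"
    by (rule computableE[OF F ls])
  note c = computesD[OF this]
  have ls': "0 < Suc s" "\<forall>l\<in>set ls. l < Suc s" using ls by auto
  \<comment> \<open>Evaluation of the second operand from slot \<open>Suc s\<close> on protects the
    first one in slot \<open>s\<close>.\<close>
  obtain d K' where "computes mem B vs ls (Suc s) G d K'"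
    by (rule computableE[OF G ls(1) ls'])
  note d = computesD[OF this]
  let ?c = "seq (seq c d) (\<lambda>_. [ins (2 * s + 1) (2 * s + 1) (2 * Suc s + 1)])"
  have "hoare ?c (\<lambda>w X. w = [] \<and> X = X0) ((B \<sigma> + 2) ^ (K + K' + 1 + 1 + 1))
          (\<lambda>w X. w = [] \<and> X (2 * s + 1) = f (F \<sigma>) (G \<sigma>) \<and> agree s X0 X)"
    if B: "B \<sigma> > 0" and rep: "represents (mem \<sigma>) (B \<sigma>) (map (\<lambda>v. v \<sigma>) vs) ls X0" for \<sigma> X0
  proof -
    have 2: "hoare d (\<lambda>w X. w = [] \<and> X (2 * s + 1) = F \<sigma> \<and> agree s X0 X) ((B \<sigma> + 2) ^ K')
      (\<lambda>w X. w = [] \<and> X (2 * s + 1) = F \<sigma> \<and> X (2 * Suc s + 1) = G \<sigma> \<and> agree s X0 X)"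
      unfolding hoare_def
    proof (intro allI impI)
      fix w :: "bool list" and X assume *: "w = [] \<and> X (2 * s + 1) = F \<sigma> \<and> agree s X0 X"
      then have "represents (mem \<sigma>) (B \<sigma>) (map (\<lambda>v. v \<sigma>) vs) ls X"
        using represents_agree[OF rep] ls by blast
      from hoareD[OF d[OF B this], of w X] * obtain t w' X' where t: "t \<le> (B \<sigma> + 2) ^ K'"
        "runs d w X w' X' t" "w' = []" "X' (2 * Suc s + 1) = G \<sigma>" "agree (Suc s) X X'"
        by blast
      moreover have "X' (2 * s + 1) = F \<sigma>" using agree_nth[OF t(5), of s] * by simp
      moreover have "agree s X0 X'" using agree_trans[OF _ agree_mono[OF t(5)]] * by auto
      ultimately show "\<exists>t\<le>(B \<sigma> + 2) ^ K'. \<exists>w' X'. runs d w X w' X' t \<and> w' = [] \<and> X' (2 * s + 1) = F \<sigma> \<and>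
          X' (2 * Suc s + 1) = G \<sigma> \<and> agree s X0 X'" by blast
    qed
    have 3: "hoare (\<lambda>_. [ins (2 * s + 1) (2 * s + 1) (2 * Suc s + 1)])
      (\<lambda>w X. w = [] \<and> X (2 * s + 1) = F \<sigma> \<and> X (2 * Suc s + 1) = G \<sigma> \<and> agree s X0 X)
      (length [ins (2 * s + 1) (2 * s + 1) (2 * Suc s + 1)])
      (\<lambda>w X. w = [] \<and> X (2 * s + 1) = f (F \<sigma>) (G \<sigma>) \<and> agree s X0 X)"
      by (rule hoare_straight) (simp_all add: ins(1) ins(2)[unfolded One_nat_def] agree_upd[unfolded Suc_eq_plus1[symmetric]])
    have le: "(B \<sigma> + 2) ^ K + (B \<sigma> + 2) ^ K' + length [ins (2 * s + 1) (2 * s + 1) (2 * Suc s + 1)]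
      \<le> (B \<sigma> + 2) ^ (K + K' + 1 + 1 + 1)"
      using add_power_le[of "B \<sigma>" K K'] const_le_power[of 1 "B \<sigma>"]
        add_power_le[of "B \<sigma>" "K + K' + 1" 1] unfolding list.size by linarith
    show ?thesis
      by (rule hoare_conseq[OF hoare_seq[OF hoare_seq[OF c[OF B rep] 2] 3] _ le])
  qed
  then show "\<exists>c K. computes mem B vs ls s (\<lambda>\<sigma>. f (F \<sigma>) (G \<sigma>)) c K" by (rule computesI)
qed

lemma computable_plus:
  "computable mem B vs F \<Longrightarrow> computable mem B vs G \<Longrightarrow> computable mem B vs (\<lambda>\<sigma>. F \<sigma> + G \<sigma>)"
  by (rule computable_binop[where ins = Add]) auto

lemma computable_minus:
  "computable mem B vs F \<Longrightarrow> computable mem B vs G \<Longrightarrow> computable mem B vs (\<lambda>\<sigma>. F \<sigma> - G \<sigma>)"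
  by (rule computable_binop[where ins = Sub]) auto

lemma computable_mem:
  assumes F: "computable mem B vs F"
  shows "computable mem B vs (\<lambda>\<sigma>. mem \<sigma> (F \<sigma>))"
proof (rule computableI)
  fix ls :: "nat list" and s :: nat
  assume ls: "length ls = length vs" "0 < s" "\<forall>l\<in>set ls. l < s"
  obtain c K where "computes mem B vs ls s F c K"
    by (rule computableE[OF F ls])
  note c = computesD[OF this]
  let ?r = "2 * s + 1"
  \<comment> \<open>Memory cell \<open>a\<close> is register \<open>2 * a\<close>, so the address is
    doubled first.\<close>
  let ?is = "[Add ?r ?r ?r, Load ?r ?r]"
  have "hoare (seq c (\<lambda>_. ?is)) (\<lambda>w X. w = [] \<and> X = X0) ((B \<sigma> + 2) ^ (K + length ?is + 1))
          (\<lambda>w X. w = [] \<and> X ?r = mem \<sigma> (F \<sigma>) \<and> agree s X0 X)"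
    if B: "B \<sigma> > 0" and rep: "represents (mem \<sigma>) (B \<sigma>) (map (\<lambda>v. v \<sigma>) vs) ls X0" for \<sigma> X0
  proof -
    have odd_neq: "2 * F \<sigma> \<noteq> Suc (2 * s)" by presburger
    have 2: "hoare (\<lambda>_. ?is) (\<lambda>w X. w = [] \<and> X ?r = F \<sigma> \<and> agree s X0 X) (length ?is)
        (\<lambda>w X. w = [] \<and> X ?r = mem \<sigma> (F \<sigma>) \<and> agree s X0 X)"
    proof (rule hoare_straight)
      fix w :: "bool list" and X assume "w = [] \<and> X ?r = F \<sigma> \<and> agree s X0 X"
      then show "fst (effect ?is (w, X)) = [] \<and> snd (effect ?is (w, X)) ?r = mem \<sigma> (F \<sigma>) \<and>
          agree s X0 (snd (effect ?is (w, X)))"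
        using rep agree_even[of s X0 X "F \<sigma>"] odd_neq unfolding represents_def
        by (auto simp: agree_def mult_2[symmetric])
    qed simp
    show ?thesis by (rule hoare_conseq[OF hoare_seq[OF c[OF B rep] 2] _ add_const_power_le])
  qed
  then show "\<exists>c K. computes mem B vs ls s (\<lambda>\<sigma>. mem \<sigma> (F \<sigma>)) c K" by (rule computesI)
qed

text \<open>The body of a loop is a function of the state together with the loop index. As with de
  Bruijn indices, \<open>snd\<close> becomes the first variable and the old ones are
  shifted.\<close>

abbreviation lift :: "('s \<Rightarrow> 'b) \<Rightarrow> 's \<times> nat \<Rightarrow> 'b" where
  "lift f \<equiv> (\<lambda>p. f (fst p))"

lemma computable_lift:
  assumes "computable mem B vs F"
  shows "computable (lift mem) (lift B) (snd # map lift vs) (lift F)"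
proof (rule computableI)
  fix ls :: "nat list" and s :: nat
  assume "length ls = length (snd # map lift vs)" "0 < s" "\<forall>l\<in>set ls. l < s"
  then obtain l ls' where ls: "ls = l # ls'" "length ls' = length vs" "0 < s" "\<forall>l\<in>set ls'. l < s"
    by (cases ls) auto
  obtain c K where "computes mem B vs ls' s F c K"
    by (rule computableE[OF assms ls(2,3,4)])
  note c = computesD[OF this]
  have "hoare c (\<lambda>w X. w = [] \<and> X = X0) ((lift B \<sigma> + 2) ^ K)
          (\<lambda>w X. w = [] \<and> X (2 * s + 1) = lift F \<sigma> \<and> agree s X0 X)"
    if "lift B \<sigma> > 0" "represents (lift mem \<sigma>) (lift B \<sigma>) (map (\<lambda>v. v \<sigma>) (snd # map lift vs)) ls X0" for \<sigma> X0
    by (rule c) (use that ls in \<open>auto simp: represents_def comp_def\<close>)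
  then show "\<exists>c K. computes (lift mem) (lift B) (snd # map lift vs) ls s (lift F) c K" by (rule computesI)
qed

text \<open>This is the only loop in the expression language; quantifiers, products and quotients
  are reduced to it. One more factor \<open>B \<sigma> + 2\<close> pays for the rounds.\<close>

lemma computable_sum:
  assumes F: "computable (lift mem) (lift B) (snd # map lift vs) (\<lambda>p. F (fst p) (snd p))"
  shows "computable mem B vs (\<lambda>\<sigma>. \<Sum>i<B \<sigma>. F \<sigma> i)"
proof (rule computableI)
  fix ls :: "nat list" and s :: nat
  assume ls: "length ls = length vs" "0 < s" "\<forall>l\<in>set ls. l < s"
  let ?acc = "2 * s + 1" let ?cnt = "2 * Suc s + 1" let ?tmp = "2 * Suc (Suc s) + 1"
  have ls': "length (Suc s # ls) = length (snd # map lift vs)" "0 < Suc (Suc s)"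
    "\<forall>l\<in>set (Suc s # ls). l < Suc (Suc s)" using ls by auto
  obtain c K where "computes (lift mem) (lift B) (snd # map lift vs) (Suc s # ls) (Suc (Suc s)) (\<lambda>p. F (fst p) (snd p)) c K"
    by (rule computableE[OF F ls'])
  note c = computesD[OF this]
  let ?init = "[SetConst ?acc 0, SetConst ?cnt 0]"
  \<comment> \<open>The last instruction subtracts the counter from the bound in register 1: the
    result is positive exactly if a round is left.\<close>
  let ?is = "[Add ?acc ?acc ?tmp, SetConst ?tmp 1, Add ?cnt ?cnt ?tmp, Sub ?tmp 1 ?cnt]"
  let ?body = "seq c (\<lambda>_. ?is)"
  have "hoare (seq (\<lambda>_. ?init) (do_while ?tmp ?body)) (\<lambda>w X. w = [] \<and> X = X0) ((B \<sigma> + 2) ^ Suc (K + 5 + 1))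
          (\<lambda>w X. w = [] \<and> X ?acc = (\<Sum>i<B \<sigma>. F \<sigma> i) \<and> agree s X0 X)"
    if B: "B \<sigma> > 0" and rep: "represents (mem \<sigma>) (B \<sigma>) (map (\<lambda>v. v \<sigma>) vs) ls X0" for \<sigma> X0
  proof -
    define Inv where "Inv n = (\<lambda>(w :: bool list) X. w = [] \<and> X ?acc = (\<Sum>i<n. F \<sigma> i) \<and> X ?cnt = n \<and> agree s X0 X)" for n
    have body: "hoare ?body (Inv i) ((B \<sigma> + 2) ^ K + 4) (\<lambda>w X. Inv (Suc i) w X \<and> (X ?tmp > 0 \<longleftrightarrow> Suc i < B \<sigma>))"
      if "i < B \<sigma>" for i
    proof -
      have 1: "hoare c (Inv i) ((B \<sigma> + 2) ^ K) (\<lambda>w X. Inv i w X \<and> X ?tmp = F \<sigma> i)"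
        unfolding hoare_def
      proof (intro allI impI)
        fix w X assume *: "Inv i w X"
        then have ag: "agree s X0 X" and X: "X ?cnt = i" "X ?acc = (\<Sum>i<i. F \<sigma> i)" "w = []"
          unfolding Inv_def by blast+
        have "represents (mem \<sigma>) (B \<sigma>) (map (\<lambda>v. v \<sigma>) vs) ls X"
          using represents_agree[OF rep ag] ls by blast
        then have "represents (lift mem (\<sigma>, i)) (lift B (\<sigma>, i)) (map (\<lambda>v. v (\<sigma>, i)) (snd # map lift vs)) (Suc s # ls) X"
          using X by (simp add: represents_def comp_def)
        from hoareD[OF c[OF _ this], of w X] B X(3) obtain t w' X' where t: "t \<le> (B \<sigma> + 2) ^ K"
          "runs c w X w' X' t" "w' = []" "X' ?tmp = F \<sigma> i" "agree (Suc (Suc s)) X X'"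
          unfolding fst_conv snd_conv by blast
        have "X' ?acc = X ?acc" "X' ?cnt = X ?cnt"
          using agree_nth[OF t(5), of s] agree_nth[OF t(5), of "Suc s"] by auto
        moreover have "agree s X0 X'" using agree_trans[OF ag agree_mono[OF t(5)]] by simp
        ultimately have "Inv i w' X'" unfolding Inv_def using X t by simp
        then show "\<exists>t\<le>(B \<sigma> + 2) ^ K. \<exists>w' X'. runs c w X w' X' t \<and> Inv i w' X' \<and> X' ?tmp = F \<sigma> i"
          using t by blast
      qed
      have 2: "hoare (\<lambda>_. ?is) (\<lambda>w X. Inv i w X \<and> X ?tmp = F \<sigma> i) (length ?is)
          (\<lambda>w X. Inv (Suc i) w X \<and> (X ?tmp > 0 \<longleftrightarrow> Suc i < B \<sigma>))"
      proof (rule hoare_straight)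
        fix w X assume *: "Inv i w X \<and> X ?tmp = F \<sigma> i"
        then have "X 1 = B \<sigma>" using rep ls unfolding Inv_def represents_def agree_def by auto
        then show "Inv (Suc i) (fst (effect ?is (w, X))) (snd (effect ?is (w, X))) \<and>
          (snd (effect ?is (w, X)) ?tmp > 0 \<longleftrightarrow> Suc i < B \<sigma>)"
          using * ls(2) unfolding Inv_def by (auto simp: agree_def)
      qed simp
      show ?thesis by (rule hoare_conseq[OF hoare_seq[OF 1 2]]) auto
    qed
    have init: "hoare (\<lambda>_. ?init) (\<lambda>w X. w = [] \<and> X = X0) (length ?init) (Inv 0)"
      by (rule hoare_straight) (auto simp: Inv_def agree_def)
    let ?b = "B \<sigma> + 2"
    have "?b ^ K + 5 \<le> ?b ^ (K + 5 + 1)" by (rule add_const_power_le)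
    then have "Suc (?b ^ K + 4) \<le> ?b ^ (K + 5 + 1)" by linarith
    then have "B \<sigma> * Suc (?b ^ K + 4) \<le> B \<sigma> * ?b ^ (K + 5 + 1)" by (rule mult_le_mono2)
    moreover have "1 \<le> ?b ^ (K + 5 + 1)" by (rule one_le_power) simp
    moreover have "length ?init = 2" by simp
    ultimately have "length ?init + B \<sigma> * Suc (?b ^ K + 4) \<le> 2 * ?b ^ (K + 5 + 1) + B \<sigma> * ?b ^ (K + 5 + 1)"
      by linarith
    also have "\<dots> = ?b ^ Suc (K + 5 + 1)"
      unfolding power_Suc distrib_right by (rule add.commute)
    finally have le: "length ?init + B \<sigma> * Suc (?b ^ K + 4) \<le> ?b ^ Suc (K + 5 + 1)" .
    show ?thesis
      by (rule hoare_conseq[OF hoare_seq[OF init hoare_do_while[OF body B]] _ le]) (auto simp: Inv_def)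
  qed
  then show "\<exists>c K. computes mem B vs ls s (\<lambda>\<sigma>. \<Sum>i<B \<sigma>. F \<sigma> i) c K" by (rule computesI)
qed

section \<open>Decidable predicates and bounded arithmetic\<close>

abbreviation decidable :: "('s \<Rightarrow> nat \<Rightarrow> nat) \<Rightarrow> ('s \<Rightarrow> nat) \<Rightarrow> ('s \<Rightarrow> nat) list \<Rightarrow> ('s \<Rightarrow> bool) \<Rightarrow> bool" where
  "decidable mem B vs P \<equiv> computable mem B vs (\<lambda>\<sigma>. of_bool (P \<sigma>))"

lemma decidable_not:
  assumes "decidable mem B vs P"
  shows "decidable mem B vs (\<lambda>\<sigma>. \<not> P \<sigma>)"
proof -
  have "computable mem B vs (\<lambda>\<sigma>. 1 - of_bool (P \<sigma>))"
    by (intro computable_minus computable_const assms)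
  also have "(\<lambda>\<sigma>. 1 - of_bool (P \<sigma>)) = (\<lambda>\<sigma>. of_bool (\<not> P \<sigma>) :: nat)"
    by (auto simp: fun_eq_iff of_bool_def)
  finally show ?thesis .
qed

lemma decidable_conj:
  assumes "decidable mem B vs P" "decidable mem B vs Q"
  shows "decidable mem B vs (\<lambda>\<sigma>. P \<sigma> \<and> Q \<sigma>)"
proof -
  have "computable mem B vs (\<lambda>\<sigma>. 1 - ((1 - of_bool (P \<sigma>)) + (1 - of_bool (Q \<sigma>))))"
    by (intro computable_minus computable_plus computable_const assms)
  also have "(\<lambda>\<sigma>. 1 - ((1 - of_bool (P \<sigma>)) + (1 - of_bool (Q \<sigma>)))) = (\<lambda>\<sigma>. of_bool (P \<sigma> \<and> Q \<sigma>) :: nat)"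
    by (auto simp: fun_eq_iff of_bool_def)
  finally show ?thesis .
qed

lemma decidable_disj:
  assumes "decidable mem B vs P" "decidable mem B vs Q"
  shows "decidable mem B vs (\<lambda>\<sigma>. P \<sigma> \<or> Q \<sigma>)"
proof -
  have "decidable mem B vs (\<lambda>\<sigma>. \<not> (\<not> P \<sigma> \<and> \<not> Q \<sigma>))"
    by (intro decidable_not decidable_conj assms)
  then show ?thesis unfolding de_Morgan_conj not_not .
qed

lemma decidable_imp:
  assumes "decidable mem B vs P" "decidable mem B vs Q"
  shows "decidable mem B vs (\<lambda>\<sigma>. P \<sigma> \<longrightarrow> Q \<sigma>)"
  unfolding imp_conv_disj by (intro decidable_disj decidable_not assms)

lemma decidable_le:
  assumes "computable mem B vs F" "computable mem B vs G"
  shows "decidable mem B vs (\<lambda>\<sigma>. F \<sigma> \<le> G \<sigma>)"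
proof -
  have "computable mem B vs (\<lambda>\<sigma>. 1 - (F \<sigma> - G \<sigma>))"
    by (intro computable_minus computable_const assms)
  also have "(\<lambda>\<sigma>. 1 - (F \<sigma> - G \<sigma>)) = (\<lambda>\<sigma>. of_bool (F \<sigma> \<le> G \<sigma>))"
    by (auto simp: fun_eq_iff of_bool_def)
  finally show ?thesis .
qed

lemma decidable_less:
  assumes "computable mem B vs F" "computable mem B vs G"
  shows "decidable mem B vs (\<lambda>\<sigma>. F \<sigma> < G \<sigma>)"
  unfolding not_le[symmetric] by (intro decidable_not decidable_le assms)

lemma decidable_eq:
  assumes "computable mem B vs F" "computable mem B vs G"
  shows "decidable mem B vs (\<lambda>\<sigma>. F \<sigma> = G \<sigma>)"
  unfolding order.eq_iff by (intro decidable_conj decidable_le assms)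

lemma decidable_ex:
  assumes "decidable (lift mem) (lift B) (snd # map lift vs) (\<lambda>p. P (fst p) (snd p))"
  shows "decidable mem B vs (\<lambda>\<sigma>. \<exists>i<B \<sigma>. P \<sigma> i)"
proof -
  \<comment> \<open>Double truncated subtraction turns the number of witnesses into a truth
    value.\<close>
  have "computable mem B vs (\<lambda>\<sigma>. 1 - (1 - (\<Sum>i<B \<sigma>. of_bool (P \<sigma> i))))"
    by (intro computable_minus computable_const computable_sum assms)
  also have "(\<lambda>\<sigma>. 1 - (1 - (\<Sum>i<B \<sigma>. of_bool (P \<sigma> i)))) = (\<lambda>\<sigma>. of_bool (\<exists>i<B \<sigma>. P \<sigma> i) :: nat)"
  proof
    fix \<sigma>
    define S :: nat where "S = (\<Sum>i<B \<sigma>. of_bool (P \<sigma> i))"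
    have "S = 0 \<longleftrightarrow> \<not> (\<exists>i<B \<sigma>. P \<sigma> i)" unfolding S_def by auto
    then show "1 - (1 - (\<Sum>i<B \<sigma>. of_bool (P \<sigma> i))) = (of_bool (\<exists>i<B \<sigma>. P \<sigma> i) :: nat)"
      unfolding S_def[symmetric] by (cases "\<exists>i<B \<sigma>. P \<sigma> i") auto
  qed
  finally show ?thesis .
qed

lemma decidable_all:
  assumes "decidable (lift mem) (lift B) (snd # map lift vs) (\<lambda>p. P (fst p) (snd p))"
  shows "decidable mem B vs (\<lambda>\<sigma>. \<forall>i<B \<sigma>. P \<sigma> i)"
proof -
  have "decidable mem B vs (\<lambda>\<sigma>. \<not> (\<exists>i<B \<sigma>. \<not> P \<sigma> i))"
    by (intro decidable_not decidable_ex assms)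
  then show ?thesis by simp
qed

text \<open>Used for the pebble indices: the program contains one copy of the test for each of them,
  so that \<open>i\<close> can serve as a fixed exponent in \<open>bdigit\<close>.\<close>

lemma decidable_all_const:
  fixes r :: nat
  assumes "\<And>i. i < r \<Longrightarrow> decidable mem B vs (P i)"
  shows "decidable mem B vs (\<lambda>\<sigma>. \<forall>i<r. P i \<sigma>)"
  using assms
proof (induction r)
  case 0
  then show ?case using computable_const[of mem B vs 1] by simp
next
  case (Suc r)
  then have "decidable mem B vs (\<lambda>\<sigma>. P r \<sigma> \<and> (\<forall>i<r. P i \<sigma>))" by (intro decidable_conj) auto
  then show ?case by (simp add: All_less_Suc)
qed

text \<open>All loops run up to \<open>b\<close>, so that these operations are the usual ones only on arguments up to \<open>b\<close>.\<close>

definition bmult :: "nat \<Rightarrow> nat \<Rightarrow> nat \<Rightarrow> nat" where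
  "bmult b x y = (\<Sum>i<b. y - (\<Sum>j<b. 1 - (x - i)))"

definition bdiv :: "nat \<Rightarrow> nat \<Rightarrow> nat \<Rightarrow> nat" where
  "bdiv b x y = (\<Sum>i<b. of_bool (bmult b (i + 1) y \<le> x))"

definition bmod :: "nat \<Rightarrow> nat \<Rightarrow> nat \<Rightarrow> nat" where
  "bmod b x y = x - bmult b (bdiv b x y) y"

fun bpower :: "nat \<Rightarrow> nat \<Rightarrow> nat \<Rightarrow> nat" where
  "bpower b x 0 = 1"
| "bpower b x (Suc i) = bmult b x (bpower b x i)"

definition bdigit :: "nat \<Rightarrow> nat \<Rightarrow> nat \<Rightarrow> nat \<Rightarrow> nat" where
  "bdigit b L i x = bmod b (bdiv b x (bpower b L i)) L"

definition digit :: "nat \<Rightarrow> nat \<Rightarrow> nat \<Rightarrow> nat" where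
  "digit L i x = x div L ^ i mod L"

text \<open>The inner sum is a branch-free test: it vanishes for \<open>i < x\<close> and equals
  \<open>b\<close>, hence at least \<open>y\<close>, for \<open>i \<ge> x\<close>. So exactly the
  first \<open>x\<close> summands are \<open>y\<close>.\<close>

lemma bmult: "x \<le> b \<Longrightarrow> y \<le> b \<Longrightarrow> bmult b x y = x * y"
proof -
  assume xy: "x \<le> b" "y \<le> b"
  have "bmult b x y = (\<Sum>i<b. if i < x then y else 0)"
    unfolding bmult_def by (rule sum.cong) (use xy in auto)
  also have "\<dots> = (\<Sum>i<x. y)"
    by (subst sum.inter_filter[symmetric]) (use xy in \<open>auto intro!: arg_cong2[where f = sum] simp del: sum_constant\<close>)
  finally show ?thesis by simp
qed

text \<open>The quotient is the number of positive multiples of \<open>y\<close> up to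
  \<open>x\<close>. The factors \<open>i + 1\<close> stay within \<open>b\<close>, so that
  \<open>bmult\<close> is exact on them.\<close>

lemma bdiv:
  assumes "x \<le> b" "y \<le> b" "0 < y"
  shows "bdiv b x y = x div y"
proof -
  have "bdiv b x y = (\<Sum>i<b. of_bool (i < x div y))"
    unfolding bdiv_def
  proof (rule sum.cong)
    fix i assume "i \<in> {..<b}"
    then have "bmult b (i + 1) y = (i + 1) * y" using assms by (intro bmult) auto
    moreover have "(i + 1) * y \<le> x \<longleftrightarrow> i + 1 \<le> x div y"
      using assms by (simp add: less_eq_div_iff_mult_less_eq)
    ultimately show "of_bool (bmult b (i + 1) y \<le> x) = (of_bool (i < x div y) :: nat)"
      by simp
  qed simp
  also have "\<dots> = card ({..<b} \<inter> {i. i < x div y})" by (simp add: of_bool_def sum.If_cases)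
  also have "{..<b} \<inter> {i. i < x div y} = {..<x div y}"
    using order_trans[OF div_le_dividend assms(1)] by (auto intro: less_le_trans)
  finally show ?thesis by simp
qed

lemma bmod: "x \<le> b \<Longrightarrow> y \<le> b \<Longrightarrow> 0 < y \<Longrightarrow> bmod b x y = x mod y"
  using order_trans[OF div_le_dividend, of x b y] unfolding bmod_def
  by (simp add: bdiv bmult minus_div_mult_eq_mod)

lemma bpower:
  assumes "x \<le> b" "\<forall>j<i. x ^ j \<le> b"
  shows "bpower b x i = x ^ i"
  using assms(2)
proof (induction i)
  case (Suc i)
  then show ?case using assms(1) by (simp add: bmult)
qed simp

lemma bdigit:
  assumes "x \<le> b" "0 < L" "L \<le> b" "L ^ i \<le> b"
  shows "bdigit b L i x = digit L i x"
proof -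
  have "\<forall>j<i. L ^ j \<le> b"
  proof (intro allI impI)
    fix j assume "j < i"
    then have "L ^ j \<le> L ^ i" using assms by (intro power_increasing) auto
    then show "L ^ j \<le> b" using assms(4) by (rule order_trans)
  qed
  then have "bpower b L i = L ^ i" using assms by (intro bpower) auto
  moreover have "x div L ^ i \<le> b" using assms(1) by (rule order_trans[OF div_le_dividend])
  ultimately show ?thesis unfolding bdigit_def digit_def using assms by (simp add: bdiv bmod)
qed

lemma computable_bmult:
  assumes "computable mem B vs F" "computable mem B vs G"
  shows "computable mem B vs (\<lambda>\<sigma>. bmult (B \<sigma>) (F \<sigma>) (G \<sigma>))"
  unfolding bmult_def
  by (intro computable_sum computable_minus computable_const computable_lift[OF assms(2)]
      computable_lift[OF computable_lift[OF assms(1)]]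
      computable_lift[where F = snd] computable_var) auto

lemma computable_bdiv:
  assumes "computable mem B vs F" "computable mem B vs G"
  shows "computable mem B vs (\<lambda>\<sigma>. bdiv (B \<sigma>) (F \<sigma>) (G \<sigma>))"
  unfolding bdiv_def
  by (intro computable_sum decidable_le computable_bmult[where B = "lift B"] computable_plus computable_const computable_lift[OF assms(1)]
      computable_lift[OF assms(2)] computable_var) auto

lemma computable_bmod:
  assumes "computable mem B vs F" "computable mem B vs G"
  shows "computable mem B vs (\<lambda>\<sigma>. bmod (B \<sigma>) (F \<sigma>) (G \<sigma>))"
  unfolding bmod_def by (intro computable_minus computable_bmult computable_bdiv assms)

lemma computable_bpower:
  "computable mem B vs F \<Longrightarrow> computable mem B vs (\<lambda>\<sigma>. bpower (B \<sigma>) (F \<sigma>) i)"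
  by (induction i) (auto intro: computable_bmult computable_const[of _ _ _ "Suc 0"])

lemma computable_bdigit:
  assumes "computable mem B vs F" "computable mem B vs G"
  shows "computable mem B vs (\<lambda>\<sigma>. bdigit (B \<sigma>) (F \<sigma>) i (G \<sigma>))"
  unfolding bdigit_def by (intro computable_bmod computable_bdiv computable_bpower assms)

section \<open>The stages of the program: reading, enlarging the bound, filling the table\<close>

datatype state = State (mem: "nat \<Rightarrow> nat") (bound: nat) (rows: nat) (base: nat) (num_verts: nat) (idx: nat)

abbreviation vars :: "(state \<Rightarrow> nat) list" where
  "vars \<equiv> [rows, base, num_verts, idx]"

text \<open>The slots 1 to 4 are the registers 3, 5, 7, 9. Slot 5, register 11, receives values of
  expressions, and register 13 is scratch. In spite of its name, \<open>rows\<close> will hold the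
  number of positions, which is the length of a row.\<close>

definition holds :: "state \<Rightarrow> bool list \<Rightarrow> (nat \<Rightarrow> nat) \<Rightarrow> bool" where
  "holds \<sigma> w X \<longleftrightarrow> w = [] \<and> represents (mem \<sigma>) (bound \<sigma>) (map (\<lambda>v. v \<sigma>) vars) [1, 2, 3, 4] X"

lemma holds_iff: "holds (State m b N L n y) w X \<longleftrightarrow>
    w = [] \<and> (\<forall>a. X (2 * a) = m a) \<and> X 1 = b \<and> X 3 = N \<and> X 5 = L \<and> X 7 = n \<and> X 9 = y"
  unfolding holds_def represents_def by auto

lemma hoare_compute:
  assumes "computable mem bound vars F"
  shows "\<exists>c K. \<forall>\<sigma>. bound \<sigma> > 0 \<longrightarrow>
    hoare c (holds \<sigma>) ((bound \<sigma> + 2) ^ K) (\<lambda>w X. holds \<sigma> w X \<and> X 11 = F \<sigma>)"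
proof -
  have *: "length [1, 2, 3, 4 :: nat] = length vars" "0 < (5 :: nat)" "\<forall>l\<in>set [1, 2, 3, 4]. l < (5 :: nat)"
    by auto
  obtain c K where c: "computes mem bound vars [1, 2, 3, 4] 5 F c K"
    by (rule computableE[OF assms *])
  have "hoare c (holds \<sigma>) ((bound \<sigma> + 2) ^ K) (\<lambda>w X. holds \<sigma> w X \<and> X 11 = F \<sigma>)"
    if "bound \<sigma> > 0" for \<sigma>
    unfolding hoare_def
  proof (intro allI impI)
    fix w X assume X: "holds \<sigma> w X"
    then have rep: "represents (mem \<sigma>) (bound \<sigma>) (map (\<lambda>v. v \<sigma>) vars) [1, 2, 3, 4] X" and w: "w = []"
      unfolding holds_def by blast+
    from hoareD[OF computesD[OF c that rep], of w X] w obtain t w' X' where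
      t: "t \<le> (bound \<sigma> + 2) ^ K" "runs c w X w' X' t" "w' = []" "X' (2 * 5 + 1) = F \<sigma>" "agree 5 X X'"
      by blast
    have "holds \<sigma> w' X'" unfolding holds_def using t(3) represents_agree[OF rep t(5) *(2,3)] by blast
    then show "\<exists>t\<le>(bound \<sigma> + 2) ^ K. \<exists>w' X'. runs c w X w' X' t \<and> holds \<sigma> w' X' \<and> X' 11 = F \<sigma>"
      using t by auto
  qed
  then show ?thesis by blast
qed

text \<open>Every loop runs up to register 1, so this register itself has to grow before the program
  can range over all positions. A loop can at best square it, and constantly many squarings keep it
  polynomial.\<close>

lemma hoare_square:
  "\<exists>c K. \<forall>m b N L n y. b > 0 \<longrightarrow>
    hoare c (holds (State m b N L n y)) ((b + 2) ^ K) (holds (State m (b * b) N L n y))"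
proof -
  have "computable mem bound vars (\<lambda>\<sigma>. \<Sum>i<bound \<sigma>. bound \<sigma>)"
    by (intro computable_sum computable_lift computable_bound)
  from hoare_compute[OF this] obtain c K where c: "\<And>\<sigma>. bound \<sigma> > 0 \<Longrightarrow>
    hoare c (holds \<sigma>) ((bound \<sigma> + 2) ^ K) (\<lambda>w X. holds \<sigma> w X \<and> X 11 = (\<Sum>i<bound \<sigma>. bound \<sigma>))" by blast
  let ?is = "[SetConst 1 0, Add 1 1 11]"
  have "hoare (seq c (\<lambda>_. ?is)) (holds (State m b N L n y)) ((b + 2) ^ (K + length ?is + 1))
      (holds (State m (b * b) N L n y))" if "b > 0" for m b N L n y
  proof -
    let ?s = "State m b N L n y"
    have 1: "hoare c (holds ?s) ((b + 2) ^ K) (\<lambda>w X. holds ?s w X \<and> X 11 = b * b)"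
      using c[of ?s] that by simp
    have 2: "hoare (\<lambda>_. ?is) (\<lambda>w X. holds ?s w X \<and> X 11 = b * b) (length ?is) (holds (State m (b * b) N L n y))"
    proof (rule hoare_straight)
      fix w X assume "holds ?s w X \<and> X 11 = b * b"
      then show "holds (State m (b * b) N L n y) (fst (effect ?is (w, X))) (snd (effect ?is (w, X)))"
        unfolding holds_iff by simp
    qed simp
    show ?thesis by (rule hoare_conseq[OF hoare_seq[OF 1 2] _ add_const_power_le])
  qed
  then show ?thesis by blast
qed

lemma hoare_squares:
  "\<exists>c K. \<forall>m b N L n y. b > 0 \<longrightarrow>
    hoare c (holds (State m b N L n y)) ((b ^ 2 ^ i + 2) ^ K) (holds (State m (b ^ 2 ^ i) N L n y))"
proof (induction i)
  case 0
  have "hoare (\<lambda>_. []) (holds (State m b N L n y)) ((b ^ 2 ^ 0 + 2) ^ 0) (holds (State m (b ^ 2 ^ 0) N L n y))"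
    for m b N L n y
    by (rule hoare_conseq[OF hoare_straight[of "[]" "holds (State m b N L n y)" "holds (State m b N L n y)"]]) auto
  then show ?case by blast
next
  case (Suc i)
  then obtain c K where c: "\<And>m b N L n y. b > 0 \<Longrightarrow>
    hoare c (holds (State m b N L n y)) ((b ^ 2 ^ i + 2) ^ K) (holds (State m (b ^ 2 ^ i) N L n y))" by blast
  obtain d K' where d: "\<And>m b N L n y. b > 0 \<Longrightarrow>
    hoare d (holds (State m b N L n y)) ((b + 2) ^ K') (holds (State m (b * b) N L n y))"
    using hoare_square by blast
  have "hoare (seq c d) (holds (State m b N L n y)) ((b ^ 2 ^ Suc i + 2) ^ (K + K' + 1))
     (holds (State m (b ^ 2 ^ Suc i) N L n y))" if b: "b > 0" for m b N L n y
  proof -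
    have sq: "b ^ 2 ^ i * b ^ 2 ^ i = b ^ 2 ^ Suc i" by (simp add: mult_2 flip: power_add)
    have pos: "b ^ 2 ^ i > 0" using b by simp
    have "b ^ 2 ^ i \<le> b ^ 2 ^ Suc i" using b by (intro power_increasing) auto
    then have "(b ^ 2 ^ i + 2) ^ K \<le> (b ^ 2 ^ Suc i + 2) ^ K" "(b ^ 2 ^ i + 2) ^ K' \<le> (b ^ 2 ^ Suc i + 2) ^ K'"
      by (intro power_mono add_right_mono; simp)+
    then have le: "(b ^ 2 ^ i + 2) ^ K + (b ^ 2 ^ i + 2) ^ K' \<le> (b ^ 2 ^ Suc i + 2) ^ (K + K' + 1)"
      using add_power_le[of "b ^ 2 ^ Suc i" K K'] by linarith
    show ?thesis
      by (rule hoare_conseq[OF hoare_seq[OF c[OF b] d[OF pos, unfolded sq]] _ le])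
  qed
  then show ?case by blast
qed

definition leading_ones :: "nat \<Rightarrow> (nat \<Rightarrow> nat) \<Rightarrow> nat" where
  "leading_ones b m = (\<Sum>i<b. of_bool (\<forall>j<b. j \<le> i \<longrightarrow> m j = 1))"

lemma hoare_leading_ones:
  "\<exists>c K. \<forall>m b N L n y. b > 0 \<longrightarrow>
    hoare c (holds (State m b N L n y)) ((b + 2) ^ K) (holds (State m b N L (leading_ones b m) y))"
proof -
  have mem: "decidable (lift (lift mem)) (lift (lift bound)) (snd # map lift (snd # map lift vars))
      (\<lambda>p. lift (lift mem) p (snd p) = 1)"
    by (intro decidable_eq computable_mem computable_const computable_var) simp
  have "computable mem bound vars (\<lambda>\<sigma>. leading_ones (bound \<sigma>) (mem \<sigma>))"
    unfolding leading_ones_def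
    by (intro computable_sum decidable_all[where B = "lift bound"] decidable_imp decidable_le mem computable_var) auto
  from hoare_compute[OF this] obtain c K where c: "\<And>\<sigma>. bound \<sigma> > 0 \<Longrightarrow>
    hoare c (holds \<sigma>) ((bound \<sigma> + 2) ^ K) (\<lambda>w X. holds \<sigma> w X \<and> X 11 = leading_ones (bound \<sigma>) (mem \<sigma>))" by blast
  let ?is = "[SetConst 7 0, Add 7 7 11]"
  have "hoare (seq c (\<lambda>_. ?is)) (holds (State m b N L n y)) ((b + 2) ^ (K + length ?is + 1))
      (holds (State m b N L (leading_ones b m) y))" if "b > 0" for m b N L n y
  proof -
    let ?s = "State m b N L n y"
    have 1: "hoare c (holds ?s) ((b + 2) ^ K) (\<lambda>w X. holds ?s w X \<and> X 11 = leading_ones b m)"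
      using c[of ?s] that by simp
    have 2: "hoare (\<lambda>_. ?is) (\<lambda>w X. holds ?s w X \<and> X 11 = leading_ones b m) (length ?is)
        (holds (State m b N L (leading_ones b m) y))"
    proof (rule hoare_straight)
      fix w X assume "holds ?s w X \<and> X 11 = leading_ones b m"
      moreover have "2 * a \<noteq> 7" for a :: nat by presburger
      ultimately show "holds (State m b N L (leading_ones b m) y) (fst (effect ?is (w, X))) (snd (effect ?is (w, X)))"
        unfolding holds_iff by simp
    qed simp
    show ?thesis by (rule hoare_conseq[OF hoare_seq[OF 1 2] _ add_const_power_le])
  qed
  then show ?thesis by blast
qed

text \<open>Course-of-values recursion: \<open>G\<close> sees all earlier entries in memory and the
  number of the current one in \<open>idx\<close>.\<close>

primrec table :: "(state \<Rightarrow> nat) \<Rightarrow> state \<Rightarrow> nat \<Rightarrow> nat \<Rightarrow> nat" where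
  "table G \<sigma> 0 = mem \<sigma>"
| "table G \<sigma> (Suc i) = (table G \<sigma> i)(bound \<sigma> + i :=
     G (State (table G \<sigma> i) (bound \<sigma>) (rows \<sigma>) (base \<sigma>) (num_verts \<sigma>) i))"

lemma hoare_table:
  assumes "computable mem bound vars G"
  shows "\<exists>c K. \<forall>m b N L n. b > 0 \<longrightarrow>
    hoare c (holds (State m b N L n 0)) (b * Suc ((b + 2) ^ K))
      (holds (State (table G (State m b N L n 0) b) b N L n b))"
proof -
  from hoare_compute[OF assms] obtain c K where c: "\<And>\<sigma>. bound \<sigma> > 0 \<Longrightarrow>
    hoare c (holds \<sigma>) ((bound \<sigma> + 2) ^ K) (\<lambda>w X. holds \<sigma> w X \<and> X 11 = G \<sigma>)" by blast
  \<comment> \<open>The target is memory cell \<open>b + i\<close>, that is, register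
    \<open>2 * (b + i)\<close>.\<close>
  let ?is = "[Add 13 1 9, Add 13 13 13, Store 13 11, SetConst 13 1, Add 9 9 13, Sub 13 1 9]"
  have "hoare (do_while 13 (seq c (\<lambda>_. ?is))) (holds (State m b N L n 0)) (b * Suc ((b + 2) ^ (K + length ?is + 1)))
      (holds (State (table G (State m b N L n 0) b) b N L n b))" if b: "b > 0" for m b N L n
  proof -
    let ?T = "table G (State m b N L n 0)"
    let ?S = "\<lambda>i. State (?T i) b N L n i"
    have body: "hoare (seq c (\<lambda>_. ?is)) (holds (?S i)) ((b + 2) ^ (K + length ?is + 1))
       (\<lambda>w X. holds (?S (Suc i)) w X \<and> (X 13 > 0 \<longleftrightarrow> Suc i < b))" if "i < b" for i
    proof -
      have 1: "hoare c (holds (?S i)) ((b + 2) ^ K) (\<lambda>w X. holds (?S i) w X \<and> X 11 = G (?S i))"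
        using c[of "?S i"] b by simp
      have 2: "hoare (\<lambda>_. ?is) (\<lambda>w X. holds (?S i) w X \<and> X 11 = G (?S i)) (length ?is)
          (\<lambda>w X. holds (?S (Suc i)) w X \<and> (X 13 > 0 \<longleftrightarrow> Suc i < b))"
      proof (rule hoare_straight)
        fix w X assume *: "holds (?S i) w X \<and> X 11 = G (?S i)"
        have odd: "2 * a \<noteq> 13" "2 * a \<noteq> 11" "2 * a \<noteq> 9" "2 * a \<noteq> 7" "2 * a \<noteq> 5" "2 * a \<noteq> 3" "2 * a \<noteq> Suc 0"
          "13 \<noteq> 2 * a" "11 \<noteq> 2 * a" "9 \<noteq> 2 * a" "7 \<noteq> 2 * a" "5 \<noteq> 2 * a" "3 \<noteq> 2 * a" "Suc 0 \<noteq> 2 * a" for a :: nat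
          by presburger+
        show "holds (?S (Suc i)) (fst (effect ?is (w, X))) (snd (effect ?is (w, X))) \<and>
            (snd (effect ?is (w, X)) 13 > 0 \<longleftrightarrow> Suc i < b)"
          using * odd odd[of "b + i"] unfolding holds_iff by (simp flip: mult_2)
      qed simp
      show ?thesis by (rule hoare_conseq[OF hoare_seq[OF 1 2] _ add_const_power_le])
    qed
    show ?thesis
      by (rule hoare_conseq[OF hoare_do_while[where Inv = "\<lambda>i. holds (?S i)", OF body b]]) auto
  qed
  then show ?thesis by blast
qed

definition input :: "bool list \<Rightarrow> nat \<Rightarrow> nat" where
  "input w a = (if a < length w then of_bool (w ! a) else if a = length w then 2 else 0)"

lemma hoare_read:
  "\<exists>c. \<forall>w. hoare c (\<lambda>w' X. w' = w \<and> X = (\<lambda>_. 0)) (Suc (length w) * 9 + 2)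
     (holds (State (input w) (Suc (length w)) 0 (Suc (length w)) 0 0))"
proof -
  \<comment> \<open>Register 9 is the next even register. The loop ends once the end marker 2 has
    been stored, as \<open>2 - 2 = 0\<close>; register 5 counts this marker too, hence
    \<open>Suc (length w)\<close>.\<close>
  let ?is = "[Read 11, Store 9 11, SetConst 13 1, Add 5 5 13, Add 9 9 13, Add 9 9 13, SetConst 13 2, Sub 13 13 11]"
  let ?fin = "[SetConst 9 0, Add 1 1 5]"
  have "hoare (seq (do_while 13 (\<lambda>_. ?is)) (\<lambda>_. ?fin)) (\<lambda>w' X. w' = w \<and> X = (\<lambda>_. 0)) (Suc (length w) * 9 + 2)
     (holds (State (input w) (Suc (length w)) 0 (Suc (length w)) 0 0))" for w
  proof -
    let ?n = "Suc (length w)"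
    define Inv where "Inv i = (\<lambda>w' X. w' = drop i w \<and> (\<forall>a. X (2 * a) = (if a < i then input w a else 0)) \<and>
      X 5 = i \<and> X 9 = 2 * i \<and> X 1 = 0 \<and> X 3 = 0 \<and> X 7 = (0 :: nat))" for i
    have body: "hoare (\<lambda>_. ?is) (Inv i) (length ?is) (\<lambda>w' X. Inv (Suc i) w' X \<and> (X 13 > 0 \<longleftrightarrow> Suc i < ?n))"
      if "i < ?n" for i
    proof (rule hoare_straight)
      fix w' X assume *: "Inv i w' X"
      have odd: "2 * a \<noteq> 13" "2 * a \<noteq> 11" "2 * a \<noteq> 9" "2 * a \<noteq> 7" "2 * a \<noteq> 5" "2 * a \<noteq> 3" "2 * a \<noteq> Suc 0"
        "13 \<noteq> 2 * a" "11 \<noteq> 2 * a" "9 \<noteq> 2 * a" "7 \<noteq> 2 * a" "5 \<noteq> 2 * a" "3 \<noteq> 2 * a" "Suc 0 \<noteq> 2 * a" for a :: nat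
        by presburger+
      show "Inv (Suc i) (fst (effect ?is (w', X))) (snd (effect ?is (w', X))) \<and>
          (snd (effect ?is (w', X)) 13 > 0 \<longleftrightarrow> Suc i < ?n)"
      proof (cases "i < length w")
        case True
        then have "w' = (w ! i) # drop (Suc i) w" using * unfolding Inv_def by (simp add: Cons_nth_drop_Suc)
        then show ?thesis using * odd True unfolding Inv_def
          by (auto simp: input_def less_Suc_eq)
      next
        case False
        then have "w' = []" "i = length w" using * that unfolding Inv_def by auto
        then show ?thesis using * odd unfolding Inv_def
          by (auto simp: input_def less_Suc_eq)
      qed
    qed simp
    have 1: "hoare (do_while 13 (\<lambda>_. ?is)) (Inv 0) (?n * Suc (length ?is)) (Inv ?n)"
      by (rule hoare_do_while[OF body]) auto
    have 2: "hoare (\<lambda>_. ?fin) (Inv ?n) (length ?fin) (holds (State (input w) ?n 0 ?n 0 0))"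
    proof (rule hoare_straight)
      fix w' X assume *: "Inv ?n w' X"
      have odd: "2 * a \<noteq> 9" "2 * a \<noteq> Suc 0" for a :: nat by presburger+
      have "input w a = 0" if "\<not> a < ?n" for a using that by (simp add: input_def)
      then show "holds (State (input w) ?n 0 ?n 0 0) (fst (effect ?fin (w', X))) (snd (effect ?fin (w', X)))"
        using * odd unfolding Inv_def holds_iff by simp
    qed simp
    show ?thesis
      by (rule hoare_conseq[OF hoare_seq[OF 1 2]]) (auto simp: Inv_def)
  qed
  then show ?thesis by blast
qed

lemma decides_within_if_hoare:
  assumes "hoare c (\<lambda>w' X. w' = w \<and> X = (\<lambda>_. 0)) T (\<lambda>w X. X 0 = of_bool A)"
  shows "decides_within (c 0) T w A"
proof -
  from hoareD[OF assms] obtain t w' X' where t: "t \<le> T" "runs c w (\<lambda>_. 0) w' X' t" "X' 0 = of_bool A"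
    by blast
  have "(step (c 0) ^^ t) (0, w, \<lambda>_. 0) = (length (c 0), w', X')"
    using t(2)[unfolded runs_def, rule_format, of "[]" "[]"] by simp
  then show ?thesis using t unfolding decides_within_def
    by (intro exI[of _ t]) (simp add: init_def halted_def accepting_def)
qed

text \<open>The exponent of \<open>L\<close> is a power of two because it comes from repeated
  squaring. A table of \<open>N ^ 2\<close> entries would end with row \<open>N - 1\<close>, one
  short of what \<open>live_stable\<close> asks for; hence two squarings and
  \<open>N ^ 4\<close>.\<close>

definition final_state :: "(state \<Rightarrow> nat) \<Rightarrow> nat \<Rightarrow> bool list \<Rightarrow> state" where
  "final_state G R w = (let L = Suc (length w); N = L ^ 2 ^ R; b = N ^ 4; n = leading_ones b (input w)
     in State (table G (State (input w) b N L n 0) b) b N L n b)"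

text \<open>The interface to the machine: what remains is to supply a computable table entry and a
  decidable test of the finished table.\<close>

theorem decides_within_table:
  assumes G: "computable mem bound vars G" and A: "decidable mem bound vars A"
  shows "\<exists>P p. \<forall>w. decides_within P (poly p (length w)) w (A (final_state G R w))"
proof -
  obtain c1 where c1: "\<And>w. hoare c1 (\<lambda>w' X. w' = w \<and> X = (\<lambda>_. 0)) (Suc (length w) * 9 + 2)
     (holds (State (input w) (Suc (length w)) 0 (Suc (length w)) 0 0))"
    using hoare_read by blast
  obtain c2 K2 where c2: "\<And>m b N L n y. b > 0 \<Longrightarrow>
    hoare c2 (holds (State m b N L n y)) ((b ^ 2 ^ R + 2) ^ K2) (holds (State m (b ^ 2 ^ R) N L n y))"
    using hoare_squares[of R] by blast
  have c3: "hoare (\<lambda>_. [SetConst 3 0, Add 3 3 1]) (holds (State m b N L n y)) (length [SetConst 3 0, Add 3 3 1])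
      (holds (State m b b L n y))" for m b N L n y
  proof (rule hoare_straight)
    fix w X assume *: "holds (State m b N L n y) w X"
    have odd: "2 * a \<noteq> 3" for a :: nat by presburger
    show "holds (State m b b L n y) (fst (effect [SetConst 3 0, Add 3 3 1] (w, X)))
        (snd (effect [SetConst 3 0, Add 3 3 1] (w, X)))"
      using * odd unfolding holds_iff by simp
  qed simp
  obtain c4 K4 where c4: "\<And>m b N L n y. b > 0 \<Longrightarrow>
    hoare c4 (holds (State m b N L n y)) ((b ^ 2 ^ 2 + 2) ^ K4) (holds (State m (b ^ 2 ^ 2) N L n y))"
    using hoare_squares[of 2] by blast
  obtain c5 K5 where c5: "\<And>m b N L n y. b > 0 \<Longrightarrow>
    hoare c5 (holds (State m b N L n y)) ((b + 2) ^ K5) (holds (State m b N L (leading_ones b m) y))"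
    using hoare_leading_ones by blast
  obtain c6 K6 where c6: "\<And>m b N L n. b > 0 \<Longrightarrow>
    hoare c6 (holds (State m b N L n 0)) (b * Suc ((b + 2) ^ K6))
      (holds (State (table G (State m b N L n 0) b) b N L n b))"
    using hoare_table[OF G] by blast
  obtain c7 K7 where c7: "\<And>\<sigma>. bound \<sigma> > 0 \<Longrightarrow>
    hoare c7 (holds \<sigma>) ((bound \<sigma> + 2) ^ K7) (\<lambda>w X. holds \<sigma> w X \<and> X 11 = of_bool (A \<sigma>))"
    using hoare_compute[OF A] by blast
  have c8: "hoare (\<lambda>_. [SetConst 0 0, Add 0 0 11]) (\<lambda>w X. holds \<sigma> w X \<and> X 11 = of_bool (A \<sigma>))
      (length [SetConst 0 0, Add 0 0 11]) (\<lambda>w X. X 0 = of_bool (A \<sigma>))" for \<sigma>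
    by (rule hoare_straight) auto
  let ?c = "seq (seq (seq (seq (seq (seq (seq c1 c2) (\<lambda>_. [SetConst 3 0, Add 3 3 1])) c4) c5) c6) c7)
    (\<lambda>_. [SetConst 0 0, Add 0 0 11])"
  define q :: "nat poly" where "q = [:1, 1:]"
  define pb where "pb = (q ^ 2 ^ R) ^ 2 ^ 2"
  \<comment> \<open>One summand for each of the eight stages; \<open>q\<close> evaluates to
    \<open>L\<close> and \<open>pb\<close> to \<open>b\<close>.\<close>
  define p where "p = q * 9 + 2 + (q ^ 2 ^ R + 2) ^ K2 + 2 + (pb + 2) ^ K4 + (pb + 2) ^ K5 +
    pb * (1 + (pb + 2) ^ K6) + (pb + 2) ^ K7 + 2"
  have *: "decides_within (?c 0) (poly p (length w)) w
      (A (State (table G (State (input w) b N l n 0) b) b N l n b))"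
    if "l = Suc (length w)" "N = l ^ 2 ^ R" "b = N ^ 4" "n = leading_ones b (input w)" for w l N b n
  proof (rule decides_within_if_hoare[where c = "?c"])
    have b: "b = N ^ 2 ^ 2" using that by simp
    have pos: "0 < l" "0 < N" "0 < b" using that by auto
    let ?T = "table G (State (input w) b N l n 0) b"
    let ?S = "State ?T b N l n b"
    note h1 = c1[of w, folded that(1)]
    note h2 = hoare_seq[OF h1 c2[OF pos(1), folded that(2)]]
    note h3 = hoare_seq[OF h2 c3]
    note h4 = hoare_seq[OF h3 c4[OF pos(2), folded b]]
    note h5 = hoare_seq[OF h4 c5[where m = "input w", OF pos(3), folded that(4)]]
    note h6 = hoare_seq[OF h5 c6[OF pos(3)]]
    note h7 = hoare_seq[OF h6 c7[of ?S, unfolded state.sel, OF pos(3)]]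
    note h8 = hoare_seq[OF h7 c8]
    have pl: "poly q (length w) = l" using that by (simp add: q_def)
    show "hoare ?c (\<lambda>w' X. w' = w \<and> X = (\<lambda>_. 0)) (poly p (length w)) (\<lambda>w X. X 0 = of_bool (A ?S))"
      by (rule hoare_conseq[OF h8])
        (auto simp: p_def pb_def pl b that(2) algebra_simps)
  qed
  have "decides_within (?c 0) (poly p (length w)) w (A (final_state G R w))" for w
    unfolding final_state_def Let_def by (rule *[OF refl refl refl refl])
  then show ?thesis by blast
qed

section \<open>The pebble game\<close>

text \<open>A position \<open>x < L ^ r\<close> consists of \<open>r\<close> pebbles: its \<open>i\<close>-th digit \<open>v * (k + 1) + c\<close> in base \<open>L\<close> means
  that pebble \<open>i\<close> gives the colour \<open>c\<close> to the vertex \<open>v\<close>.\<close>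

locale pebble_game = p5_free_graph E for E +
  fixes k r n L :: nat and l :: "nat \<Rightarrow> nat set"
  assumes L: "0 < L" and pairs: "n * Suc k \<le> L"
    and lists: "\<And>v. v < n \<Longrightarrow> l v \<subseteq> {1..k}"
begin

abbreviation "N \<equiv> L ^ r"

definition vx :: "nat \<Rightarrow> nat \<Rightarrow> nat" where "vx i x = digit L i x div Suc k"
definition cx :: "nat \<Rightarrow> nat \<Rightarrow> nat" where "cx i x = digit L i x mod Suc k"

definition pebbles :: "nat \<Rightarrow> (nat \<times> nat) set" where "pebbles x = (\<lambda>i. (vx i x, cx i x)) ` {..<r}"

lemma proper_subset:
  assumes "proper f" "g \<subseteq> f"
  shows "proper g"
proof -
  have "\<forall>p\<in>f. \<forall>q\<in>f. (fst p = fst q \<longrightarrow> snd p = snd q) \<and> (E (fst p) (fst q) \<longrightarrow> snd p \<noteq> snd q)"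
    using assms(1) unfolding proper_def case_prod_beta .
  then show ?thesis using assms(2) unfolding proper_def case_prod_beta by blast
qed

definition start :: "nat \<Rightarrow> bool" where
  "start x \<longleftrightarrow> (\<forall>i<r. vx i x < n \<and> cx i x \<in> l (vx i x)) \<and>
     (\<forall>i<r. \<forall>j<r. (vx i x = vx j x \<longrightarrow> cx i x = cx j x) \<and> (E (vx i x) (vx j x) \<longrightarrow> cx i x \<noteq> cx j x))"

text \<open>\<open>live j x\<close> says that \<open>x\<close> survives \<open>j\<close> rounds of
  elimination. To survive, it needs for every move of one pebble an answering colour that leads to a
  survivor of the previous round.\<close>

fun live :: "nat \<Rightarrow> nat \<Rightarrow> bool" where
  "live 0 x \<longleftrightarrow> start x"
| "live (Suc j) x \<longleftrightarrow> live j x \<and> (\<forall>i<r. \<forall>v<n. \<exists>z<N. live j z \<and> vx i z = v \<and>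
     (\<forall>i'<r. i' \<noteq> i \<longrightarrow> digit L i' z = digit L i' x))"

lemma live_antimono: "j \<le> j' \<Longrightarrow> live j' x \<Longrightarrow> live j x"
  by (induction rule: dec_induct) auto

lemma live_start: "live j x \<Longrightarrow> start x"
  using live_antimono[of 0 j x] by simp

text \<open>The sets of survivors decrease and have at most \<open>N\<close> elements, so two
  consecutive ones coincide within the first \<open>N + 1\<close> rounds. From then on nothing
  changes, since a round depends only on the survivors of the one before.\<close>

lemma live_stable:
  assumes "N \<le> j" "x < N" "live j x"
  shows "live (Suc j) x"
proof -
  let ?S = "\<lambda>j. {x. x < N \<and> live j x}"
  have fin: "finite (?S j)" for j by simp
  have "\<exists>i\<le>N. ?S (Suc i) = ?S i"
  proof (rule ccontr)
    assume *: "\<not> ?thesis"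
    have "card (?S i) + i \<le> N" if "i \<le> Suc N" for i
      using that
    proof (induction i)
      case 0
      have "card (?S 0) \<le> card {..<N}" by (rule card_mono) auto
      then show ?case by simp
    next
      case (Suc i)
      have "?S (Suc i) \<subset> ?S i" using * Suc.prems by fastforce
      then have "card (?S (Suc i)) < card (?S i)" by (rule psubset_card_mono[OF fin])
      then show ?case using Suc by simp
    qed
    from this[of "Suc N"] show False by simp
  qed
  then obtain i where i: "i \<le> N" "?S (Suc i) = ?S i" by blast
  have eq: "live (Suc i') x \<longleftrightarrow> live i' x" if "i \<le> i'" "x < N" for i' x
    using that
  proof (induction i' arbitrary: x rule: dec_induct)
    case base
    then show ?case using i(2) by blast
  next
    case (step i')
    then show ?case by (metis (no_types, lifting) live.simps(2))
  qed
  have "live (Suc j) x \<longleftrightarrow> live j x"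
    by (rule eq[OF order_trans[OF i(1) assms(1)] assms(2)])
  then show ?thesis using assms(3) by blast
qed

lemma digits_exist:
  assumes "\<And>i. i < s \<Longrightarrow> d i < L"
  shows "\<exists>x < L ^ s. \<forall>i<s. digit L i x = d i"
  using assms
proof (induction s arbitrary: d)
  case (Suc s)
  obtain x where x: "x < L ^ s" "\<And>i. i < s \<Longrightarrow> digit L i x = d (Suc i)"
    using Suc.IH[of "\<lambda>i. d (Suc i)"] Suc.prems by auto
  have d0: "d 0 < L" using Suc.prems by simp
  let ?x = "d 0 + L * x"
  have "?x < L + L * x" using d0 by simp
  also have "\<dots> = L * Suc x" by simp
  also have "\<dots> \<le> L * L ^ s" using x(1) by (intro mult_le_mono2) simp
  finally have "?x < L ^ Suc s" by simp
  moreover have "digit L i ?x = d i" if "i < Suc s" for i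
  proof (cases i)
    case 0
    then show ?thesis using d0 by (simp add: digit_def)
  next
    case (Suc j)
    have "?x div L ^ Suc j = x div L ^ j"
      using d0 L by (simp add: div_mult2_eq)
    then show ?thesis using x(2)[of j] that Suc by (simp add: digit_def)
  qed
  ultimately show ?case by blast
qed (use L in auto)

text \<open>Positions that follow a fixed list colouring are start positions and answer each other's
  moves, so no round deletes any of them. Vertex \<open>0\<close> provides one.\<close>

lemma live_if_colouring:
  assumes col: "\<And>v. v < n \<Longrightarrow> col v \<in> l v" "\<And>u v. u < n \<Longrightarrow> v < n \<Longrightarrow> E u v \<Longrightarrow> col u \<noteq> col v"
    and n: "0 < n"
  shows "\<exists>x<N. live j x"
proof -
  define G where "G = {x. x < N \<and> (\<forall>i<r. \<exists>v<n. digit L i x = v * Suc k + col v)}"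
  have colk: "col v < Suc k" if "v < n" for v using col(1) lists that by force
  have code: "v * Suc k + col v < L" if "v < n" for v
  proof -
    have "v * Suc k + col v < v * Suc k + Suc k" using colk that by simp
    also have "\<dots> = Suc v * Suc k" by simp
    also have "\<dots> \<le> n * Suc k" using that by (intro mult_le_mono1) simp
    finally show ?thesis using pairs by simp
  qed
  have vc: "vx i x = v" "cx i x = col v" if "digit L i x = v * Suc k + col v" "v < n" for i x v
    using colk[OF that(2)] that(1) unfolding vx_def cx_def
    by (simp_all only: div_mult_self3 mod_mult_self3 div_less mod_less)
  have "live j x" if "x \<in> G" for x j
    using that
  proof (induction j arbitrary: x)
    case 0
    then have ex: "\<exists>v<n. vx i x = v \<and> cx i x = col v" if "i < r" for i
      using vc that unfolding G_def by blast
    have "start x" unfolding start_def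
    proof (intro conjI allI impI)
      fix i assume "i < r"
      then show "vx i x < n" "cx i x \<in> l (vx i x)" using ex col(1) by metis+
      fix j assume "j < r"
      then show "vx i x = vx j x \<Longrightarrow> cx i x = cx j x" "E (vx i x) (vx j x) \<Longrightarrow> cx i x \<noteq> cx j x"
        using ex[OF \<open>i < r\<close>] ex[OF \<open>j < r\<close>] col(2) by auto
    qed
    then show ?case by simp
  next
    case (Suc j)
    have "\<exists>z<N. live j z \<and> vx i z = v \<and> (\<forall>i'<r. i' \<noteq> i \<longrightarrow> digit L i' z = digit L i' x)"
      if iv: "i < r" "v < n" for i v
    proof -
      let ?d = "\<lambda>i'. if i' = i then v * Suc k + col v else digit L i' x"
      have "?d i' < L" for i' using code[OF iv(2)] L by (simp add: digit_def)
      then obtain z where z: "z < N" "\<And>i'. i' < r \<Longrightarrow> digit L i' z = ?d i'"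
        using digits_exist[of r ?d] by blast
      have "\<exists>v<n. digit L i' z = v * Suc k + col v" if "i' < r" for i'
        using z(2)[OF that] that iv Suc.prems unfolding G_def by (cases "i' = i") auto
      then have "z \<in> G" unfolding G_def using z(1) by blast
      moreover have "vx i z = v" using vc(1)[of i z v] z(2)[OF iv(1)] iv by simp
      ultimately show ?thesis using z Suc.IH by (intro exI[of _ z]) auto
    qed
    then show ?case using Suc by simp
  qed
  moreover obtain x where "x < N" "\<And>i. i < r \<Longrightarrow> digit L i x = 0 * Suc k + col 0"
    using digits_exist[of r "\<lambda>_. 0 * Suc k + col 0"] code[OF n] by blast
  ultimately show ?thesis using n unfolding G_def by blast
qed

text \<open>Stationary survivors yield a consistent family: the sets of pairs that lie on the
  pebbles of a surviving position. Its width is \<open>r\<close>, which is why at least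
  \<open>width k\<close> pebbles are used.\<close>

lemma colouring_if_live:
  assumes x: "x < N" "live j x" and j: "N \<le> j" and r: "width k \<le> r"
  shows "\<exists>col. (\<forall>v<n. col v \<in> l v) \<and> (\<forall>u<n. \<forall>v<n. E u v \<longrightarrow> col u \<noteq> col v)"
proof -
  define H where "H = {h. \<exists>x<N. live j x \<and> h \<subseteq> pebbles x}"
  have finite_pebbles: "finite (pebbles x)" for x unfolding pebbles_def by simp
  have memH: "\<exists>x. x < N \<and> live j x \<and> h \<subseteq> pebbles x" if "h \<in> H" for h
    using that unfolding H_def by simp
  have start: "vx i x < n" "cx i x \<in> l (vx i x)" if "live j x" "i < r" for i x
    using live_start[OF that(1)] that(2) unfolding start_def by blast+
  have H1: "finite h" if "h \<in> H" for h using memH[OF that] finite_pebbles finite_subset by blast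
  have H2: "h \<subseteq> {..<n} \<times> {1..k}" if h: "h \<in> H" for h
  proof -
    obtain x where x: "live j x" "h \<subseteq> pebbles x" using memH[OF h] by blast
    have "vx i x < n \<and> cx i x \<in> {1..k}" if "i < r" for i
      using start[OF x(1) that] lists[of "vx i x"] by blast
    then show ?thesis using x(2) unfolding pebbles_def by fastforce
  qed
  have H3: "proper h" if h: "h \<in> H" for h
  proof -
    obtain x where x: "live j x" "h \<subseteq> pebbles x" using memH[OF h] by blast
    have "start x" using live_start x by blast
    then have "\<forall>i\<in>{..<r}. \<forall>j\<in>{..<r}. (vx i x = vx j x \<longrightarrow> cx i x = cx j x) \<and>
        (E (vx i x) (vx j x) \<longrightarrow> cx i x \<noteq> cx j x)"
      unfolding start_def by blast
    then have "proper (pebbles x)" unfolding proper_def pebbles_def ball_simps case_prod_conv .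
    then show ?thesis using x(2) by (rule proper_subset)
  qed
  have H4: "\<exists>c. insert (v, c) h \<in> H" if h: "h \<in> H" "card h < r" "v < n" for h v
  proof -
    obtain x where x: "x < N" "live j x" "h \<subseteq> pebbles x" using memH[OF h(1)] by blast
    have "\<forall>p\<in>h. \<exists>i<r. p = (vx i x, cx i x)" using x(3) unfolding pebbles_def by blast
    then obtain g where g: "\<And>p. p \<in> h \<Longrightarrow> g p < r \<and> p = (vx (g p) x, cx (g p) x)" by metis
    have "finite h" using x(3) finite_pebbles finite_subset by blast
    \<comment> \<open>Fewer than \<open>r\<close> pebbles are needed to show \<open>h\<close>, so a
      spare pebble can move to \<open>v\<close> while the others keep \<open>h\<close> in
      place.\<close>
    then have "card (g ` h) < r" using h(2) card_image_le le_less_trans by blast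
    then have "\<not> {..<r} \<subseteq> g ` h" using \<open>finite h\<close> card_mono[of "g ` h" "{..<r}"] by auto
    then obtain i where i: "i < r" "i \<notin> g ` h" by blast
    obtain z where z: "z < N" "live j z" "vx i z = v" "\<And>i'. i' < r \<Longrightarrow> i' \<noteq> i \<Longrightarrow> digit L i' z = digit L i' x"
      using live_stable[OF j x(1,2)] i(1) h(3) by auto
    have "p \<in> pebbles z" if "p \<in> h" for p
    proof -
      have "g p \<noteq> i" "g p < r" using i that g by auto
      then have eq: "vx (g p) z = vx (g p) x" "cx (g p) z = cx (g p) x" using z(4) by (simp_all add: vx_def cx_def)
      have "p = (vx (g p) z, cx (g p) z)" unfolding eq by (rule conjunct2[OF g[OF that]])
      then show ?thesis unfolding pebbles_def by (rule image_eqI) (use \<open>g p < r\<close> in simp)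
    qed
    moreover have "(v, cx i z) \<in> pebbles z" using i z unfolding pebbles_def by blast
    ultimately have "insert (v, cx i z) h \<in> H" unfolding H_def using z by blast
    then show ?thesis by blast
  qed
  have H5: "{} \<in> H" using x unfolding H_def by blast
  have H6: "g \<in> H" if "f \<in> H" "g \<subseteq> f" for f g using that unfolding H_def by blast
  have "consistent r {..<n} {1..k} H" unfolding consistent_def lessThan_iff
    by (intro conjI ballI allI impI)
      (rule H5 | erule (1) H6 | erule H1 | erule H2 | erule H3 | erule (1) H4; simp)+
  then have "consistent (width k) {..<n} {1..k} H" using r by (rule consistent_mono)
  then obtain col where col: "colouring_from {..<n} H col"
    using colouring_exists[of "{..<n}" "{1..k}" k H] by auto
  have "col v \<in> l v" if "v < n" for v
  proof -
    have "{(v, col v)} \<in> H" using col that unfolding colouring_from_def by blast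
    then obtain x i where "live j x" "i < r" "v = vx i x" "col v = cx i x"
      using memH unfolding pebbles_def by blast
    then show ?thesis using start(2)[of x i] by simp
  qed
  then show ?thesis using col unfolding colouring_from_def by blast
qed

end

section \<open>The table of live positions\<close>

definition pebble_vertex :: "nat \<Rightarrow> nat \<Rightarrow> nat \<Rightarrow> nat \<Rightarrow> nat \<Rightarrow> nat" where
  "pebble_vertex k b L i x = bdiv b (bdigit b L i x) (Suc k)"

definition pebble_colour :: "nat \<Rightarrow> nat \<Rightarrow> nat \<Rightarrow> nat \<Rightarrow> nat \<Rightarrow> nat" where
  "pebble_colour k b L i x = bmod b (bdigit b L i x) (Suc k)"

text \<open>The addresses follow the encoding: \<open>n + 1\<close> cells for the number of
  vertices, \<open>n * n\<close> for the matrix, then \<open>k\<close> for each list. Colour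
  \<open>c\<close> is bit \<open>c - 1\<close> of a list, and the remainder \<open>0\<close> of a
  digit stands for no colour.\<close>

definition start_cell :: "nat \<Rightarrow> nat \<Rightarrow> (nat \<Rightarrow> nat) \<Rightarrow> nat \<Rightarrow> nat \<Rightarrow> nat \<Rightarrow> nat \<Rightarrow> bool" where
  "start_cell k r m b L n x \<longleftrightarrow>
     (\<forall>i<r. pebble_vertex k b L i x < n \<and> 1 \<le> pebble_colour k b L i x \<and>
        m (n + 1 + bmult b n n + bmult b (pebble_vertex k b L i x) k + (pebble_colour k b L i x - 1)) = 1) \<and>
     (\<forall>i<r. \<forall>j<r. (pebble_vertex k b L i x = pebble_vertex k b L j x \<longrightarrow>
          pebble_colour k b L i x = pebble_colour k b L j x) \<and>
        (m (n + 1 + bmult b (pebble_vertex k b L i x) n + pebble_vertex k b L j x) = 1 \<longrightarrow>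
          pebble_colour k b L i x \<noteq> pebble_colour k b L j x))"

text \<open>For \<open>y = Suc j * N + x\<close>, the entry of \<open>x\<close> in the previous row
  is \<open>y - N\<close>, and that row starts at \<open>y - N - y mod N\<close>.\<close>

definition next_cell :: "nat \<Rightarrow> nat \<Rightarrow> (nat \<Rightarrow> nat) \<Rightarrow> nat \<Rightarrow> nat \<Rightarrow> nat \<Rightarrow> nat \<Rightarrow> nat \<Rightarrow> bool" where
  "next_cell k r m b N L n y \<longleftrightarrow> m (b + (y - N)) = 1 \<and>
     (\<forall>i<r. \<forall>v<b. v < n \<longrightarrow> (\<exists>z<b. z < N \<and> m (b + (y - N - bmod b y N) + z) = 1 \<and>
        pebble_vertex k b L i z = v \<and> (\<forall>j<r. j \<noteq> i \<longrightarrow> bdigit b L j z = bdigit b L j (bmod b y N))))"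

text \<open>The table entry \<open>j * N + x\<close>, stored at \<open>b + j * N + x\<close>, tells whether the position \<open>x\<close> survives
  \<open>j\<close> rounds of elimination.\<close>

definition cell :: "nat \<Rightarrow> nat \<Rightarrow> state \<Rightarrow> bool" where
  "cell k r \<sigma> \<longleftrightarrow>
     idx \<sigma> < rows \<sigma> \<and> start_cell k r (mem \<sigma>) (bound \<sigma>) (base \<sigma>) (num_verts \<sigma>) (idx \<sigma>) \<or>
     rows \<sigma> \<le> idx \<sigma> \<and> next_cell k r (mem \<sigma>) (bound \<sigma>) (rows \<sigma>) (base \<sigma>) (num_verts \<sigma>) (idx \<sigma>)"

text \<open>The empty graph is a case of its own: it is colourable, yet no pebble can be placed.
  Otherwise the last row is inspected, which starts \<open>N\<close> entries before the end.\<close>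

definition accept :: "state \<Rightarrow> bool" where
  "accept \<sigma> \<longleftrightarrow> num_verts \<sigma> = 0 \<or>
     (\<exists>z<bound \<sigma>. z < rows \<sigma> \<and> mem \<sigma> (bound \<sigma> + (bound \<sigma> - rows \<sigma>) + z) = 1)"

lemmas computable_rules =
  decidable_not decidable_conj decidable_disj decidable_imp decidable_less decidable_le decidable_eq
  decidable_ex decidable_all decidable_all_const
  computable_plus computable_minus computable_bmult computable_bdiv computable_bmod computable_bdigit
  computable_mem computable_bound

lemma computable_cell: "decidable mem bound vars (cell k r)"
  unfolding cell_def start_cell_def next_cell_def pebble_vertex_def pebble_colour_def
  by ((rule computable_const computable_rules | (rule computable_var, simp; fail))+)

lemma computable_accept: "decidable mem bound vars accept"
  unfolding accept_def
  by ((rule computable_const computable_rules | (rule computable_var, simp; fail))+)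

locale encoded_game = pebble_game E k r n L l for E k r n L l +
  fixes w :: "bool list"
  assumes n: "0 < n" and r: "0 < r"
    and L_eq: "L = Suc (length w)" and len: "length w = n + 1 + n * n + n * k"
    and input_adj: "\<And>u v. u < n \<Longrightarrow> v < n \<Longrightarrow> input w (n + 1 + u * n + v) = of_bool (E u v)"
    and input_list: "\<And>v c. v < n \<Longrightarrow> 1 \<le> c \<Longrightarrow> c \<le> k \<Longrightarrow>
      input w (n + 1 + n * n + v * k + (c - 1)) = of_bool (c \<in> l v)"
begin

abbreviation "b \<equiv> N ^ 4"

lemma bounds: "0 < N" "L \<le> N" "N \<le> b" "Suc k < L" "n < L" "n * n < L" "k * n < L" "2 \<le> N"
proof -
  show N: "0 < N" using L by simp
  show LN: "L \<le> N" using L r by (cases r) auto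
  show "N \<le> b" using N by (intro self_le_power) auto
  have nn: "n \<le> n * n" using n by (intro le_square)
  have "k \<le> n * k" using n by simp
  then show "Suc k < L" "n < L" "n * n < L" "k * n < L"
    using L_eq len n by (auto simp only: mult.commute[of k n])
  then show "2 \<le> N" using LN n by simp
qed

lemma power_le: "i < r \<Longrightarrow> L ^ i \<le> b"
  using bounds L order_trans[OF power_increasing[of i r L]] by auto

lemma digit_less: "digit L i x < L"
  unfolding digit_def using L by simp

lemma bdigit_eq: "i < r \<Longrightarrow> x < N \<Longrightarrow> bdigit b L i x = digit L i x"
  by (rule bdigit) (use bounds L power_le[of i] in auto)

lemma pebble_vertex_eq: "i < r \<Longrightarrow> x < N \<Longrightarrow> pebble_vertex k b L i x = vx i x"
  unfolding pebble_vertex_def vx_def using bounds digit_less[of i x]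
  by (subst bdiv) (auto simp: bdigit_eq)

lemma pebble_colour_eq: "i < r \<Longrightarrow> x < N \<Longrightarrow> pebble_colour k b L i x = cx i x"
  unfolding pebble_colour_def cx_def using bounds digit_less[of i x]
  by (subst bmod) (auto simp: bdigit_eq)

lemma cx_le: "cx i x \<le> k"
  unfolding cx_def using mod_less_divisor[of "Suc k" "digit L i x"] by linarith

lemma start_cell_iff:
  assumes m: "\<And>a. a < b \<Longrightarrow> m a = input w a" and x: "x < N"
  shows "start_cell k r m b L n x \<longleftrightarrow> start x"
proof -
  have list: "1 \<le> cx i x \<and> m (n + 1 + bmult b n n + bmult b (vx i x) k + (cx i x - 1)) = 1 \<longleftrightarrow> cx i x \<in> l (vx i x)"
    if v: "vx i x < n" for i
  proof (cases "1 \<le> cx i x")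
    case True
    have "vx i x * k + k = Suc (vx i x) * k" by simp
    also have "\<dots> \<le> n * k" using v by (intro mult_le_mono1) simp
    finally have "n + 1 + n * n + vx i x * k + (cx i x - 1) < L"
      using cx_le[of i x] True L_eq len by linarith
    moreover have "bmult b n n = n * n" "bmult b (vx i x) k = vx i x * k"
      using bounds v by (auto intro!: bmult)
    moreover have "input w (n + 1 + n * n + vx i x * k + (cx i x - 1)) = of_bool (cx i x \<in> l (vx i x))"
      by (rule input_list[OF v True cx_le])
    ultimately show ?thesis using m[of "n + 1 + n * n + vx i x * k + (cx i x - 1)"] bounds True by auto
  next
    case False
    then show ?thesis using lists[OF v] by auto
  qed
  have adj: "m (n + 1 + bmult b (vx i x) n + vx j x) = 1 \<longleftrightarrow> E (vx i x) (vx j x)"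
    if v: "vx i x < n" "vx j x < n" for i j
  proof -
    have "vx i x * n + n = Suc (vx i x) * n" by simp
    also have "\<dots> \<le> n * n" using v by (intro mult_le_mono1) simp
    finally have "n + 1 + vx i x * n + vx j x < L" using v L_eq len by linarith
    moreover have "bmult b (vx i x) n = vx i x * n" using bounds v by (auto intro!: bmult)
    ultimately show ?thesis using m[of "n + 1 + vx i x * n + vx j x"] bounds input_adj[OF v] by auto
  qed
  have eqs: "pebble_vertex k b L i x = vx i x" "pebble_colour k b L i x = cx i x" if "i < r" for i
    using pebble_vertex_eq pebble_colour_eq that x by auto
  show ?thesis
  proof (cases "\<forall>i<r. vx i x < n")
    case True
    then show ?thesis unfolding start_cell_def start_def using list adj eqs by auto
  next
    case False
    then show ?thesis unfolding start_cell_def start_def using eqs by auto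
  qed
qed

lemma next_cell_iff:
  assumes m: "\<And>y'. y' < y \<Longrightarrow> m (b + y') = of_bool (live (y' div N) (y' mod N))"
    and y: "N \<le> y" "y < b"
  shows "next_cell k r m b N L n y \<longleftrightarrow> live (y div N) (y mod N)"
proof -
  obtain j where j: "y div N = Suc j" using y bounds by (cases "y div N") (auto simp: div_eq_0_iff)
  define x where "x = y mod N"
  have xN: "x < N" using bounds unfolding x_def by simp
  have yj: "y = Suc j * N + x" unfolding x_def j[symmetric] by (rule div_mult_mod_eq[symmetric])
  have prev: "m (b + (j * N + z)) = 1 \<longleftrightarrow> live j z" if "z < N" for z
    using m[of "j * N + z"] that bounds yj by (simp add: of_bool_def)
  have x_eq: "bmod b y N = x" unfolding x_def using y bounds by (intro bmod) auto
  have q: "y - N = j * N + x" "y - N - x = j * N" using yj by auto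
  have pv: "pebble_vertex k b L i z = vx i z" if "i < r" "z < N" for i z by (rule pebble_vertex_eq[OF that])
  have bd: "bdigit b L i z = digit L i z" if "i < r" "z < N" for i z by (rule bdigit_eq[OF that])
  have nb: "n < b" "N \<le> b" using bounds by auto
  have inner: "(z < b \<and> z < N \<and> m (b + (y - N - bmod b y N) + z) = 1 \<and> pebble_vertex k b L i z = v \<and>
      (\<forall>j'<r. j' \<noteq> i \<longrightarrow> bdigit b L j' z = bdigit b L j' (bmod b y N))) \<longleftrightarrow>
      (z < N \<and> live j z \<and> vx i z = v \<and> (\<forall>i'<r. i' \<noteq> i \<longrightarrow> digit L i' z = digit L i' x))" if "i < r" for i z v
    using prev[of z] pv[OF that, of z] bd xN nb unfolding x_eq q add.assoc by auto
  have "next_cell k r m b N L n y \<longleftrightarrow> live j x \<and> (\<forall>i<r. \<forall>v<b. v < n \<longrightarrow>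
      (\<exists>z. z < N \<and> live j z \<and> vx i z = v \<and> (\<forall>i'<r. i' \<noteq> i \<longrightarrow> digit L i' z = digit L i' x)))"
    unfolding next_cell_def prev[OF xN, folded q(1)]
    by (rule conj_cong[OF refl], intro all_cong imp_cong refl ex_cong1, rule inner)
  also have "\<dots> \<longleftrightarrow> live (Suc j) x" using nb by (auto 0 3 intro: less_trans)
  finally show ?thesis unfolding j x_def .
qed

abbreviation "T \<equiv> table (\<lambda>\<sigma>. of_bool (cell k r \<sigma>)) (State (input w) b N L n 0)"

text \<open>Entries are written from cell \<open>b\<close> on, so the input stays intact, and an
  entry depends only on the previous row, which is complete by then.\<close>

lemma table_live:
  assumes "i \<le> b"
  shows "(\<forall>a<b. T i a = input w a) \<and> (\<forall>y<i. T i (b + y) = of_bool (live (y div N) (y mod N)))"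
  using assms
proof (induction i)
  case (Suc i)
  then have IH: "\<And>a. a < b \<Longrightarrow> T i a = input w a"
    "\<And>y. y < i \<Longrightarrow> T i (b + y) = of_bool (live (y div N) (y mod N))" and i: "i < b"
    by auto
  have "cell k r (State (T i) b N L n i) \<longleftrightarrow> live (i div N) (i mod N)"
  proof (cases "i < N")
    case True
    then show ?thesis using start_cell_iff[OF IH(1) True] by (simp add: cell_def[of k r "State (T i) b N L n i"])
  next
    case False
    then show ?thesis
      using next_cell_iff[OF IH(2) _ i] by (simp add: cell_def[of k r "State (T i) b N L n i"])
  qed
  then show ?case using IH by (auto simp: less_Suc_eq)
qed simp

lemma accept_iff:
  assumes "width k \<le> r"
  shows "accept (State (T b) b N L n b) \<longleftrightarrow>
    (\<exists>col. (\<forall>v<n. col v \<in> l v) \<and> (\<forall>u<n. \<forall>v<n. E u v \<longrightarrow> col u \<noteq> col v))"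
proof -
  \<comment> \<open>The number of the last row. It is at least \<open>N\<close>, where elimination
    is stationary, because \<open>2 \<le> N\<close>.\<close>
  let ?j = "N ^ 3 - 1"
  have "N * 2 ^ 2 \<le> N * N ^ 2" using bounds by (intro mult_le_mono2 power_mono) auto
  then have N3: "N \<le> ?j" using bounds by (simp add: numeral_eq_Suc)
  have "N ^ 3 * N = b" by (simp add: numeral_eq_Suc mult.commute)
  then have bN: "b - N = ?j * N" by (simp add: diff_mult_distrib)
  have row: "T b (b + (b - N) + z) = 1 \<longleftrightarrow> live ?j z" if "z < N" for z
  proof -
    have "b - N + z < b" using that bounds by linarith
    then have "T b (b + (b - N + z)) = of_bool (live ((b - N + z) div N) ((b - N + z) mod N))"
      using table_live[of b] by blast
    then show ?thesis using that bounds unfolding bN by (simp add: add.assoc of_bool_def)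
  qed
  have "accept (State (T b) b N L n b) \<longleftrightarrow> (\<exists>z. z < b \<and> z < N \<and> T b (b + (b - N) + z) = 1)"
    unfolding accept_def state.sel using n by simp
  also have "\<dots> \<longleftrightarrow> (\<exists>z. z < N \<and> live ?j z)"
  proof (rule ex_cong1)
    fix z
    show "(z < b \<and> z < N \<and> T b (b + (b - N) + z) = 1) \<longleftrightarrow> (z < N \<and> live ?j z)"
    proof (cases "z < N")
      case True
      then have "z < b" using bounds(3) by (rule less_le_trans)
      then show ?thesis using True by (simp only: row simp_thms)
    qed simp
  qed
  also have "\<dots> \<longleftrightarrow> (\<exists>col. (\<forall>v<n. col v \<in> l v) \<and> (\<forall>u<n. \<forall>v<n. E u v \<longrightarrow> col u \<noteq> col v))"
  proof
    assume "\<exists>z. z < N \<and> live ?j z"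
    then obtain z where "z < N" "live ?j z" by blast
    then show "\<exists>col. (\<forall>v<n. col v \<in> l v) \<and> (\<forall>u<n. \<forall>v<n. E u v \<longrightarrow> col u \<noteq> col v)"
      using N3 assms by (rule colouring_if_live)
  next
    assume "\<exists>col. (\<forall>v<n. col v \<in> l v) \<and> (\<forall>u<n. \<forall>v<n. E u v \<longrightarrow> col u \<noteq> col v)"
    then obtain col where col: "\<And>v. v < n \<Longrightarrow> col v \<in> l v"
      "\<And>u v. u < n \<Longrightarrow> v < n \<Longrightarrow> E u v \<Longrightarrow> col u \<noteq> col v" by blast
    show "\<exists>z. z < N \<and> live ?j z" by (rule live_if_colouring[OF col n])
  qed
  finally show ?thesis .
qed

end

section \<open>Decoding the input and the final assembly\<close>

lemma nth_concat_uniform: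
  assumes "\<And>i. i < n \<Longrightarrow> length (f i) = k"
  shows "length (concat (map f [0..<n])) = n * k"
    and "i < n \<Longrightarrow> j < k \<Longrightarrow> concat (map f [0..<n]) ! (i * k + j) = f i ! j"
  using assms
proof (induction n)
  case (Suc n)
  { case 1
    then show ?case using Suc.IH(1) by simp }
  { case 2
    have len: "length (concat (map f [0..<n])) = n * k" using Suc.IH(1) 2 by simp
    show ?case
    proof (cases "i < n")
      case True
      then have "i * k + j < Suc i * k" using 2 by simp
      also have "\<dots> \<le> n * k" using True by (intro mult_le_mono1) simp
      finally show ?thesis using True Suc.IH(2) 2 len by (simp add: nth_append)
    next
      case False
      then show ?thesis using 2 len by (simp add: nth_append less_Suc_eq)
    qed }
qed simp_all

lemma leading_ones_eq:
  assumes "n < b" "\<And>i. i < n \<Longrightarrow> m i = 1" "m n \<noteq> 1"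
  shows "leading_ones b m = n"
proof -
  have "leading_ones b m = card ({..<b} \<inter> {i. \<forall>j<b. j \<le> i \<longrightarrow> m j = 1})"
    unfolding leading_ones_def by (simp add: of_bool_def sum.If_cases)
  also have "{..<b} \<inter> {i. \<forall>j<b. j \<le> i \<longrightarrow> m j = 1} = {..<n}"
    using assms by (auto simp: not_less[symmetric])
  finally show ?thesis by simp
qed

text \<open>The adjacency pattern in \<open>no_p5\<close> already makes the five vertices distinct:
  two equal ones would be joined by a loop or disagree about some third vertex.\<close>

lemma p5_free_graph_parcs:
  assumes "pair_graph G" "P5_free G"
  shows "p5_free_graph (\<lambda>u v. (u, v) \<in> parcs G)"
proof
  interpret pair_graph G by fact
  show "(u, v) \<in> parcs G \<Longrightarrow> (v, u) \<in> parcs G" for u v by (rule arcs_symmetric)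
  show "(v, v) \<notin> parcs G" for v using no_loops' by blast
  show False if arcs: "(a, b) \<in> parcs G" "(b, c) \<in> parcs G" "(c, d) \<in> parcs G" "(d, e) \<in> parcs G"
    "(a, c) \<notin> parcs G" "(a, d) \<notin> parcs G" "(a, e) \<notin> parcs G" "(b, d) \<notin> parcs G" "(b, e) \<notin> parcs G"
    "(c, e) \<notin> parcs G" for a b c d e
  proof -
    let ?f = "\<lambda>i. [a, b, c, d, e] ! i"
    have sym: "(u, v) \<in> parcs G \<longleftrightarrow> (v, u) \<in> parcs G" for u v using arcs_symmetric by blast
    have loop: "(v, v) \<notin> parcs G" for v using no_loops' by blast
    have five: "i = 0 \<or> i = 1 \<or> i = 2 \<or> i = 3 \<or> i = 4" if "i < 5" for i :: nat using that by linarith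
    have adj: "\<forall>i<5. \<forall>j<5. (?f i, ?f j) \<in> parcs G \<longleftrightarrow> i = j + 1 \<or> j = i + 1"
      using arcs loop sym by (auto dest!: five)
    have "inj_on ?f {..<5}"
    proof (rule inj_onI)
      fix i j :: nat assume "i \<in> {..<5}" "j \<in> {..<5}" "?f i = ?f j"
      then show "i = j" using arcs loop sym by (auto dest!: five)
    qed
    moreover have "?f ` {..<5} \<subseteq> pverts G"
      using arcs by (auto dest!: five dest: in_arcsD1 in_arcsD2)
    ultimately show False using assms(2) adj unfolding P5_free_def induced_path5_def by blast
  qed
qed

lemma encode_instance:
  assumes n: "card (pverts G) = n" and w: "w = encode_instance k (G, l)"
  shows "length w = n + 1 + n * n + n * k"
    and "i < n \<Longrightarrow> input w i = 1"
    and "input w n = 0"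
    and "u < n \<Longrightarrow> v < n \<Longrightarrow> input w (n + 1 + u * n + v) = of_bool ((u, v) \<in> parcs G)"
    and "v < n \<Longrightarrow> 1 \<le> c \<Longrightarrow> c \<le> k \<Longrightarrow> input w (n + 1 + n * n + v * k + (c - 1)) = of_bool (c \<in> l v)"
proof -
  define A where "A = concat (map (\<lambda>u. map (\<lambda>v. (u, v) \<in> parcs G) [0..<n]) [0..<n])"
  define B where "B = concat (map (\<lambda>v. map (\<lambda>c. c \<in> l v) [1..<Suc k]) [0..<n])"
  have w_eq: "w = (replicate n True @ [False]) @ A @ B"
    unfolding w encode_instance_def A_def B_def using n by (simp add: Let_def)
  have lenA: "length A = n * n" unfolding A_def by (rule nth_concat_uniform) simp
  have lenB: "length B = n * k" unfolding B_def by (rule nth_concat_uniform) simp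
  show len: "length w = n + 1 + n * n + n * k" unfolding w_eq by (simp add: lenA lenB)
  show "input w i = 1" if "i < n" using that unfolding input_def w_eq by (simp add: nth_append)
  show "input w n = 0" unfolding input_def w_eq by (simp add: nth_append)
  have AB: "w ! (n + 1 + i) = (A @ B) ! i" for i
    unfolding w_eq using nth_append_length_plus[of "replicate n True @ [False]" "A @ B" i] by simp
  show "input w (n + 1 + u * n + v) = of_bool ((u, v) \<in> parcs G)" if uv: "u < n" "v < n"
  proof -
    have "u * n + v < Suc u * n" using uv by simp
    also have "\<dots> \<le> n * n" using uv by (intro mult_le_mono1) simp
    finally have less: "u * n + v < n * n" .
    have "A ! (u * n + v) = map (\<lambda>v. (u, v) \<in> parcs G) [0..<n] ! v"
      unfolding A_def by (rule nth_concat_uniform) (use uv in simp_all)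
    then have "w ! (n + 1 + (u * n + v)) = ((u, v) \<in> parcs G)"
      unfolding AB using less uv by (simp add: nth_append lenA)
    moreover have "n + 1 + (u * n + v) < length w" using less len by simp
    ultimately show ?thesis unfolding input_def by (simp only: add.assoc if_True)
  qed
  show "input w (n + 1 + n * n + v * k + (c - 1)) = of_bool (c \<in> l v)" if vc: "v < n" "1 \<le> c" "c \<le> k"
  proof -
    have "v * k + (c - 1) < Suc v * k" using vc by simp
    also have "\<dots> \<le> n * k" using vc by (intro mult_le_mono1) simp
    finally have less: "v * k + (c - 1) < n * k" .
    have "B ! (v * k + (c - 1)) = map (\<lambda>c. c \<in> l v) [1..<Suc k] ! (c - 1)"
      unfolding B_def by (rule nth_concat_uniform) (use vc in simp_all)
    also have "\<dots> = (c \<in> l v)" using vc nth_upt[of 1 "c - 1" "Suc k"] by (simp del: upt_Suc)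
    finally have "w ! (n + 1 + (n * n + (v * k + (c - 1)))) = (c \<in> l v)"
      unfolding AB lenA[symmetric] nth_append_length_plus .
    moreover have "n + 1 + (n * n + (v * k + (c - 1))) < length w" using less len by simp
    ultimately show ?thesis unfolding input_def by (simp only: add.assoc if_True)
  qed
qed

theorem theorem3:
  fixes k :: nat
  shows "poly_time_solvable {(G, l) \<in> list_colouring_instances k. P5_free G}
           (encode_instance k) list_colourable"
proof -
  \<comment> \<open>A power of two, to suit the repeated squaring in \<open>final_state\<close>, and
    at least \<open>width k\<close>.\<close>
  let ?r = "2 ^ width k"
  let ?G = "\<lambda>\<sigma>. of_bool (cell k ?r \<sigma>)"
  obtain P p where P: "\<And>w. decides_within P (poly p (length w)) w (accept (final_state ?G (width k) w))"
    using decides_within_table[OF computable_cell computable_accept, of k ?r "width k"] by blast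
  have "decides_within P (poly p (length (encode_instance k (G, l)))) (encode_instance k (G, l))
      (list_colourable (G, l))"
    if Gl: "(G, l) \<in> list_colouring_instances k" "P5_free G" for G l
  proof -
    have G: "pair_graph G" and l: "\<And>v. v \<in> pverts G \<Longrightarrow> l v \<subseteq> {1..k}"
      using Gl(1) unfolding list_colouring_instances_def by auto
    obtain n where verts: "pverts G = {..<n}" using Gl(1) unfolding list_colouring_instances_def by blast
    interpret G: pair_graph G by (rule G)
    have arcs: "u < n \<and> v < n" if "(u, v) \<in> parcs G" for u v
      using G.in_arcsD1[OF that] G.in_arcsD2[OF that] verts by simp
    define w where "w = encode_instance k (G, l)"
    have "card (pverts G) = n" using verts by simp
    note enc = encode_instance[OF this w_def]
    let ?L = "Suc (length w)"
    let ?N = "?L ^ ?r"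
    let ?b = "?N ^ 4"
    have "?L ^ 1 \<le> ?L ^ ?r" "?N ^ 1 \<le> ?N ^ 4" by (rule power_increasing; simp)+
    then have "n < ?b" using enc(1) by simp
    then have lead: "leading_ones ?b (input w) = n"
      by (rule leading_ones_eq) (simp_all add: enc(2,3))
    have final: "final_state ?G (width k) w = State (table ?G (State (input w) ?b ?N ?L n 0) ?b) ?b ?N ?L n ?b"
      unfolding final_state_def Let_def lead ..
    have col: "list_colourable (G, l) \<longleftrightarrow>
        (\<exists>c. (\<forall>v<n. c v \<in> l v) \<and> (\<forall>u<n. \<forall>v<n. (u, v) \<in> parcs G \<longrightarrow> c u \<noteq> c v))"
      unfolding list_colourable_def list_colouring_def using verts arcs by auto
    have "accept (final_state ?G (width k) w) \<longleftrightarrow> list_colourable (G, l)"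
    proof (cases "n = 0")
      case True
      then show ?thesis unfolding col accept_def final by simp
    next
      case False
      have "n * Suc k \<le> ?L" using enc(1) by simp
      interpret p5_free_graph "\<lambda>u v. (u, v) \<in> parcs G" by (rule p5_free_graph_parcs[OF G Gl(2)])
      interpret encoded_game "\<lambda>u v. (u, v) \<in> parcs G" k ?r n ?L l w
        by unfold_locales (use False enc l verts \<open>n * Suc k \<le> ?L\<close> in auto)
      show ?thesis unfolding col final by (rule accept_iff) (rule le_two_power)
    qed
    then show ?thesis using P[of w] unfolding w_def by simp
  qed
  then show ?thesis unfolding poly_time_solvable_def by blast
qed

end
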